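(* Let $k\ge 1$ be a fixed integer and let $p=p(n)\in[0,1]$. Suppose that there is some $\delta>0$ such that $p=\omega\left(n^{-1/k+\delta}\right)$ and $p=o\left(n^{-1/(k+1)-\delta}\right)$ as $n\to\infty$. Let $X(n,p)$ be the Erdős–Rényi random clique complex and let $\beta_k=\beta_k(X(n,p))$ be its $k$-th Betti number. Then, as $n\to\infty$, $$\frac{\beta_k(X(n,p))-\mathbb{E}[\beta_k(X(n,p))]}{\sqrt{\mathrm{Var}[\beta_k(X(n,p))]}}\Longrightarrow \mathcal{N}(0,1),$$ where $\Longrightarrow$ denotes convergence in distribution.
   Context: The Erdős–Rényi clique complex $X(n,p)$ is defined as follows: take a random graph on $n$ vertices in which each of the $\binom{n}{2}$ possible edges is present independently with probability $p$, and let $X(n,p)$ be the maximal simplicial complex with this graph as its 1-skeleton (i.e. the clique complex: a set of vertices is a face if and only if it spans a complete subgraph). The Betti number $\beta_k$ is the dimension of the $k$-th homology group with rational coefficients. For positive sequences, $a_n=\omega(b_n)$ means $a_n/b_n\to\infty$ and $a_n=o(b_n)$ means $a_n/b_n\to 0$. $\mathcal{N}(0,1)$ is the standard normal distribution. *)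

theory Defs
  imports "HOL-Probability.Probability" "HOL-Algebra.QuotRing" "Jordan_Normal_Form.VS_Connect"
begin

text \<open>
  An abstract simplicial complex is represented by the set of its faces, which are nonempty finite
  sets of vertices. Below, homology is only meaningful for complexes with finitely many faces in
  each dimension. The empty simplex is not a face, so the homology is unreduced.
\<close>

definition clique_complex :: "'a set \<Rightarrow> 'a set set \<Rightarrow> 'a set set" where
  "clique_complex V E =
     {\<sigma>. \<sigma> \<noteq> {} \<and> finite \<sigma> \<and> \<sigma> \<subseteq> V \<and> (\<forall>u\<in>\<sigma>. \<forall>v\<in>\<sigma>. u \<noteq> v \<longrightarrow> {u, v} \<in> E)}"

definition faces :: "nat \<Rightarrow> 'a set set \<Rightarrow> 'a set set" where
  "faces k X = {\<sigma> \<in> X. card \<sigma> = k + 1}"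

text \<open>
  Every face is oriented by the order of the vertices, so a \<open>k\<close>-chain with rational coefficients is
  a function supported on the \<open>k\<close>-faces. The fields \<open>mult\<close> and \<open>one\<close>, which
  \<^const>\<open>carrier\<close>-based modules inherit from the ring record, play no role.
\<close>

definition chain_space :: "nat \<Rightarrow> 'a set set \<Rightarrow> (rat, 'a set \<Rightarrow> rat) module" where
  "chain_space k X =
     \<lparr>carrier = {c. \<forall>\<sigma>. c \<sigma> \<noteq> 0 \<longrightarrow> \<sigma> \<in> faces k X},
      mult = undefined, one = undefined,
      zero = (\<lambda>_. 0), add = (\<lambda>c d \<sigma>. c \<sigma> + d \<sigma>), smult = (\<lambda>r c \<sigma>. r * c \<sigma>)\<rparr>"

text \<open>
  The boundary of the face \<open>x\<^sub>0 < \<dots> < x\<^sub>k\<close> is the alternating sum over \<open>i\<close> of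
  \<open>(-1)^i\<close> times the face with \<open>x\<^sub>i\<close> deleted; the position of a vertex \<open>v\<close> is the number of
  smaller vertices. The boundary of a \<open>0\<close>-chain is zero.
\<close>

definition boundary :: "nat \<Rightarrow> 'a::linorder set set \<Rightarrow> ('a set \<Rightarrow> rat) \<Rightarrow> 'a set \<Rightarrow> rat" where
  "boundary k X c \<tau> =
     (if k = 0 then 0
      else \<Sum>\<sigma>\<in>faces k X. \<Sum>v\<in>\<sigma>. if \<tau> = \<sigma> - {v} then (-1) ^ card {u \<in> \<sigma>. u < v} * c \<sigma> else 0)"

definition cycle_space :: "nat \<Rightarrow> 'a::linorder set set \<Rightarrow> (rat, 'a set \<Rightarrow> rat) module" where
  "cycle_space k X =
     (chain_space k X)\<lparr>carrier := {c \<in> carrier (chain_space k X). boundary k X c = (\<lambda>_. 0)}\<rparr>"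

definition boundaries :: "nat \<Rightarrow> 'a::linorder set set \<Rightarrow> ('a set \<Rightarrow> rat) set" where
  "boundaries k X = boundary (k + 1) X ` carrier (chain_space (k + 1) X)"

text \<open>
  The library has no quotients of vector spaces. As for its quotient rings, the elements are the
  cosets, and an operation is applied to all representatives.
\<close>

definition quotient_space :: "('a, 'b, 'c) module_scheme \<Rightarrow> 'b set \<Rightarrow> ('a, 'b set) module" where
  "quotient_space M N =
     \<lparr>carrier = a_rcosets\<^bsub>M\<^esub> N, mult = undefined, one = undefined,
      zero = N, add = set_add M,
      smult = (\<lambda>r C. \<Union>c\<in>C. N +>\<^bsub>M\<^esub> (r \<odot>\<^bsub>M\<^esub> c))\<rparr>"

definition homology :: "nat \<Rightarrow> 'a::linorder set set \<Rightarrow> (rat, ('a set \<Rightarrow> rat) set) module" where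
  "homology k X = quotient_space (cycle_space k X) (boundaries k X)"

definition betti :: "nat \<Rightarrow> 'a::linorder set set \<Rightarrow> nat" where
  "betti k X = vectorspace.dim class_ring (homology k X)"

definition potential_edges :: "nat \<Rightarrow> nat set set" where
  "potential_edges n = {e. e \<subseteq> {..<n} \<and> card e = 2}"

definition random_graph :: "nat \<Rightarrow> real \<Rightarrow> nat set set pmf" where
  "random_graph n p =
     map_pmf (\<lambda>\<omega>. {e \<in> potential_edges n. \<omega> e})
       (Pi_pmf (potential_edges n) False (\<lambda>_. bernoulli_pmf p))"

definition random_clique_complex :: "nat \<Rightarrow> real \<Rightarrow> nat set set pmf" where
  "random_clique_complex n p = map_pmf (clique_complex {..<n}) (random_graph n p)"

end

theory Submission
  imports Defs "HOL-Library.Function_Algebras"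
begin

text \<open>
  Write \<open>X = X(n, p)\<close>, let \<open>f\<^sub>j\<close> be the number of its \<open>j\<close>-faces and \<open>r\<^sub>j\<close> the rank of the boundary map
  from \<open>j\<close>-chains, so that \<open>\<beta>\<^sub>k = f\<^sub>k - r\<^sub>k - r\<^sub>k\<^sub>+\<^sub>1\<close> (lemma \<open>betti_eq\<close>). The idea is that to first order
  \<open>\<beta>\<^sub>k\<close> is a multiple \<open>\<mu> M\<close> of the number \<open>M\<close> of edges of the random graph, where \<open>\<mu>\<close> is the expected
  number of \<open>k\<close>-faces that are created by inserting a given edge. As \<open>M\<close> is binomial, it satisfies the
  de Moivre--Laplace theorem, and \<open>\<beta>\<^sub>k\<close> inherits the limit if \<open>Var(\<beta>\<^sub>k - \<mu> M) = o(\<mu>\<^sup>2 Var M)\<close>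
  (theorem \<open>clt_of_linear_approximation\<close>).

  The Efron--Stein inequality reduces this to one edge at a time: with \<open>D\<^sub>e g\<close> the increment of \<open>g\<close>
  caused by inserting the edge \<open>e\<close>, it suffices that the mean over \<open>e\<close> of \<open>E (D\<^sub>e \<beta>\<^sub>k - \<mu>)\<^sup>2\<close>
  is \<open>o(\<mu>\<^sup>2)\<close>. Here \<open>D\<^sub>e \<beta>\<^sub>k = D\<^sub>e f\<^sub>k - D\<^sub>e r\<^sub>k - D\<^sub>e r\<^sub>k\<^sub>+\<^sub>1\<close>, and the three terms are treated separately.

  \<^item> \<open>D\<^sub>e f\<^sub>k\<close> counts the \<open>(k+1)\<close>-cliques through \<open>e\<close>. Its variance is \<open>o(\<mu>\<^sup>2)\<close> because \<open>n p\<^sup>k \<rightarrow> \<infinity>\<close>.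

  \<^item> \<open>0 \<le> D\<^sub>e r\<^sub>k\<^sub>+\<^sub>1 \<le> D\<^sub>e f\<^sub>k\<^sub>+\<^sub>1\<close>, and the second moment of \<open>D\<^sub>e f\<^sub>k\<^sub>+\<^sub>1\<close> is \<open>o(\<mu>\<^sup>2)\<close> because
    \<open>n p\<^sup>k\<^sup>+\<^sup>1 \<rightarrow> 0\<close>.

  \<^item> \<open>0 \<le> D\<^sub>e r\<^sub>k \<le> D\<^sub>e f\<^sub>k\<close>, so in view of the first point only the mean of \<open>D\<^sub>e r\<^sub>k\<close> matters. It is
    controlled on average over \<open>e\<close> by a deterministic inequality for every graph (lemma
    \<open>sum_rank_drops_le\<close>): the sum over the edges \<open>e\<close> of the amount by which \<open>r\<^sub>k\<close> drops when \<open>e\<close> is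
    deleted is at most a constant times \<open>r\<^sub>k\<close>. As \<open>r\<^sub>k \<le> f\<^sub>k\<^sub>-\<^sub>1\<close>, and the expectation of \<open>f\<^sub>k\<^sub>-\<^sub>1\<close> is
    negligible against that of \<open>f\<^sub>k\<close>, the mean of \<open>D\<^sub>e r\<^sub>k\<close> is \<open>o(\<mu>)\<close>.
\<close>

section \<open>Rank functions of matroids\<close>

text \<open>
  The rank function of a matroid, given by its local axioms; the last one is submodularity for a
  single element. The example of interest is the dimension of the span of a family of vectors. Only
  finite sets count, so that the family may be indexed by an infinite type.
\<close>

locale matroid_rank =
  fixes rk :: "'a set \<Rightarrow> nat"
  assumes rk_empty: "rk {} = 0"
    and rk_insert_le: "finite A \<Longrightarrow> rk (insert x A) \<le> rk A + 1"
    and rk_insert_ge: "finite A \<Longrightarrow> rk A \<le> rk (insert x A)"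
    and rk_insert_antimono:
      "finite B \<Longrightarrow> A \<subseteq> B \<Longrightarrow> rk (insert x B) + rk A \<le> rk (insert x A) + rk B"
begin

lemma rk_mono: "finite B \<Longrightarrow> A \<subseteq> B \<Longrightarrow> rk A \<le> rk B"
proof -
  assume "finite B" "A \<subseteq> B"
  then have "finite A" by (auto intro: finite_subset)
  have "finite S \<Longrightarrow> rk A \<le> rk (A \<union> S)" for S
  proof (induction S rule: finite_induct)
    case (insert x S)
    then show ?case using rk_insert_ge[of "A \<union> S" x] \<open>finite A\<close> by simp
  qed simp
  from this[of "B - A"] \<open>finite B\<close> \<open>A \<subseteq> B\<close> show ?thesis
    by (simp add: Un_absorb1)
qed

lemma rk_Un_le: 
  assumes "finite A" "finite S" shows "rk (A \<union> S) \<le> rk A + card S"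
  using assms(2)
proof (induction S rule: finite_induct)
  case (insert x S)
  then show ?case using rk_insert_le[of "A \<union> S" x] assms(1) by simp
qed simp

lemma rk_Un_antimono:
  assumes "finite B" "A \<subseteq> B" "finite S"
  shows "rk (B \<union> S) + rk A \<le> rk (A \<union> S) + rk B"
  using assms(3)
proof (induction S rule: finite_induct)
  case (insert x S)
  have "A \<union> S \<subseteq> B \<union> S" using assms by blast
  with insert show ?case using rk_insert_antimono[of "B \<union> S" "A \<union> S" x] assms by simp
qed simp

text \<open>
  A basis of \<open>S\<close> in the matroid contracted by \<open>A\<close>. It arises by running through \<open>S\<close> and keeping the
  elements that increase the rank.
\<close>

lemma relative_basis:
  assumes "finite A" "finite S"
  obtains T where "T \<subseteq> S" "rk (A \<union> S) = rk A + card T" "\<And>U. U \<subseteq> T \<Longrightarrow> rk (A \<union> U) = rk A + card U"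
proof -
  have "\<exists>T\<subseteq>S. rk (A \<union> S) = rk A + card T \<and> rk (A \<union> T) = rk (A \<union> S)"
    using assms(2)
  proof (induction S rule: finite_induct)
    case (insert x S)
    then obtain T where T: "T \<subseteq> S" "rk (A \<union> S) = rk A + card T" "rk (A \<union> T) = rk (A \<union> S)" by blast
    have fin: "finite T" using T insert finite_subset by blast
    have le: "rk (A \<union> insert x S) \<le> rk (A \<union> S) + 1" "rk (A \<union> S) \<le> rk (A \<union> insert x S)"
      using rk_insert_le[of "A \<union> S" x] rk_insert_ge[of "A \<union> S" x] insert assms by auto
    have mono: "rk (insert x (A \<union> S)) + rk (A \<union> T) \<le> rk (insert x (A \<union> T)) + rk (A \<union> S)"
      using insert assms T by (intro rk_insert_antimono) auto
    have mono2: "rk (insert x (A \<union> T)) \<le> rk (insert x (A \<union> S))"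
      using insert assms T by (intro rk_mono) auto
    show ?case
    proof (cases "rk (A \<union> insert x S) = rk (A \<union> S)")
      case True
      then show ?thesis using T by (intro exI[of _ T]) auto
    next
      case False
      then show ?thesis using T le mono mono2 fin insert(2)
        by (intro exI[of _ "insert x T"]) (auto simp: card_insert_if)
    qed
  qed (use assms in auto)
  then obtain T where T: "T \<subseteq> S" "rk (A \<union> S) = rk A + card T" "rk (A \<union> T) = rk (A \<union> S)" by blast
  have "rk (A \<union> U) = rk A + card U" if "U \<subseteq> T" for U
  proof -
    have fin: "finite T" "finite U" using T assms(2) that finite_subset by metis+
    have "rk (A \<union> T) \<le> rk (A \<union> U) + card (T - U)"
      using rk_Un_le[of "A \<union> U" "T - U"] fin assms(1) that by (simp add: Un_assoc Un_absorb1)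
    moreover have "card T = card U + card (T - U)"
      using fin that by (simp add: card_Diff_subset card_mono)
    moreover have "rk (A \<union> U) \<le> rk A + card U" using rk_Un_le fin assms(1) by blast
    ultimately show ?thesis using T by linarith
  qed
  with T that show ?thesis by blast
qed

text \<open>
  Think of the elements of \<open>K\<close> as faces, each with a set \<open>es \<sigma>\<close> of \<open>m\<close> edges. The summand is the drop
  of the rank when all faces through \<open>e\<close> are deleted. A single drop can be large and the faces lost for
  different edges overlap, so the sum is not obviously bounded by the rank. The bound holds because for
  a random set \<open>R\<close> of edges a face has probability \<open>2\<^sup>-\<^sup>m\<close> to meet \<open>R\<close> exactly in a given one of its edges.
  For \<open>e \<in> R\<close> choose faces \<open>T e\<close> through \<open>e\<close>, as many as the drop, that are independent
  modulo the faces avoiding \<open>e\<close>; keep those that meet \<open>R\<close> in \<open>e\<close> only. A face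
  kept for some other \<open>e' \<in> R\<close> avoids \<open>e\<close>, hence all faces that are kept are independent together, and
  their number is at most the rank. Averaging over \<open>R\<close> gives the claim.
\<close>

lemma sum_rank_drops_le:
  fixes es :: "'a \<Rightarrow> 'e set"
  assumes fin: "finite K" "finite E" and es: "\<And>\<sigma>. \<sigma> \<in> K \<Longrightarrow> es \<sigma> \<subseteq> E \<and> card (es \<sigma>) = m"
  shows "(\<Sum>e\<in>E. rk K - rk {\<sigma>\<in>K. e \<notin> es \<sigma>}) \<le> 2 ^ m * rk K"
proof -
  have "\<exists>T. T \<subseteq> {\<sigma>\<in>K. e \<in> es \<sigma>} \<and> rk K = rk {\<sigma>\<in>K. e \<notin> es \<sigma>} + card T \<and>
      (\<forall>U\<subseteq>T. rk ({\<sigma>\<in>K. e \<notin> es \<sigma>} \<union> U) = rk {\<sigma>\<in>K. e \<notin> es \<sigma>} + card U)" for e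
  proof -
    let ?A = "{\<sigma>\<in>K. e \<notin> es \<sigma>}" and ?S = "{\<sigma>\<in>K. e \<in> es \<sigma>}"
    have "?A \<union> ?S = K" by auto
    moreover obtain T where "T \<subseteq> ?S" "rk (?A \<union> ?S) = rk ?A + card T"
        "\<And>U. U \<subseteq> T \<Longrightarrow> rk (?A \<union> U) = rk ?A + card U"
      by (rule relative_basis[of ?A ?S]) (use fin in auto)
    ultimately show ?thesis by (intro exI[of _ T]) auto
  qed
  then have "\<exists>T. \<forall>e. T e \<subseteq> {\<sigma>\<in>K. e \<in> es \<sigma>} \<and> rk K = rk {\<sigma>\<in>K. e \<notin> es \<sigma>} + card (T e) \<and>
      (\<forall>U\<subseteq>T e. rk ({\<sigma>\<in>K. e \<notin> es \<sigma>} \<union> U) = rk {\<sigma>\<in>K. e \<notin> es \<sigma>} + card U)"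
    by (intro choice allI)
  then obtain T where T: "\<And>e. T e \<subseteq> {\<sigma>\<in>K. e \<in> es \<sigma>}"
      "\<And>e. rk K = rk {\<sigma>\<in>K. e \<notin> es \<sigma>} + card (T e)"
      "\<And>e U. U \<subseteq> T e \<Longrightarrow> rk ({\<sigma>\<in>K. e \<notin> es \<sigma>} \<union> U) = rk {\<sigma>\<in>K. e \<notin> es \<sigma>} + card U"
    by auto
  have finT: "finite (T e)" for e using T(1)[of e] fin by (auto intro: finite_subset)
  define U where "U R e = {\<sigma> \<in> T e. es \<sigma> \<inter> R = {e}}" for R e
  \<comment> \<open>Add the edges of \<open>R\<close> one by one: the faces kept for \<open>e\<close> are independent modulo all earlier ones.\<close>
  have U_le: "(\<Sum>e\<in>R. card (U R e)) \<le> rk K" if R: "R \<subseteq> E" for R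
  proof -
    have "finite R" using R fin finite_subset by blast
    have "(\<Sum>e\<in>R'. card (U R e)) \<le> rk (\<Union>e\<in>R'. U R e)" if "R' \<subseteq> R" for R'
      using finite_subset[OF that \<open>finite R\<close>] that
    proof (induction R' rule: finite_induct)
      case (insert e R')
      let ?A = "{\<sigma>\<in>K. e \<notin> es \<sigma>}" and ?W = "\<Union>e\<in>R'. U R e"
      have sub: "?W \<subseteq> ?A"
      proof
        fix \<sigma> assume "\<sigma> \<in> ?W"
        then obtain e' where e': "e' \<in> R'" "\<sigma> \<in> T e'" "es \<sigma> \<inter> R = {e'}" by (auto simp: U_def)
        have "e \<notin> es \<sigma>" using e' insert by auto
        then show "\<sigma> \<in> ?A" using T(1)[of e'] e' by auto
      qed
      have "rk (?A \<union> U R e) + rk ?W \<le> rk (?W \<union> U R e) + rk ?A"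
        using sub fin finT by (intro rk_Un_antimono) (auto simp: U_def)
      moreover have "rk (?A \<union> U R e) = rk ?A + card (U R e)"
        by (intro T(3)) (auto simp: U_def)
      ultimately show ?case using insert by (simp add: Un_commute)
    qed simp
    from this[of R] have "(\<Sum>e\<in>R. card (U R e)) \<le> rk (\<Union>e\<in>R. U R e)" by simp
    also have "\<dots> \<le> rk K"
    proof (intro rk_mono fin UN_least)
      show "U R e \<subseteq> K" for e using T(1)[of e] by (auto simp: U_def)
    qed
    finally show ?thesis .
  qed
  \<comment> \<open>Such an \<open>R\<close> is determined by its part outside \<open>es \<sigma>\<close>.\<close>
  have count: "card {R \<in> Pow E. es \<sigma> \<inter> R = {e}} = 2 ^ (card E - m)" if "e \<in> E" "\<sigma> \<in> T e" for e \<sigma>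
  proof -
    have \<sigma>: "\<sigma> \<in> K" "e \<in> es \<sigma>" "es \<sigma> \<subseteq> E" "card (es \<sigma>) = m"
      using that T(1)[of e] es[of \<sigma>] by auto
    have "bij_betw (insert e) (Pow (E - es \<sigma>)) {R \<in> Pow E. es \<sigma> \<inter> R = {e}}"
      by (rule bij_betw_byWitness[where f' = "\<lambda>R. R - {e}"]) (use \<sigma> in auto)
    then have "card {R \<in> Pow E. es \<sigma> \<inter> R = {e}} = card (Pow (E - es \<sigma>))"
      by (simp add: bij_betw_same_card)
    also have "\<dots> = 2 ^ (card E - m)"
      using \<sigma> fin by (simp add: card_Pow card_Diff_subset finite_subset)
    finally show ?thesis .
  qed
  have "(\<Sum>e\<in>E. card (T e) * 2 ^ (card E - m)) =
      (\<Sum>e\<in>E. \<Sum>\<sigma>\<in>T e. card {R \<in> Pow E. es \<sigma> \<inter> R = {e}})"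
    using count by simp
  also have "\<dots> = (\<Sum>e\<in>E. \<Sum>\<sigma>\<in>T e. \<Sum>R\<in>Pow E. if es \<sigma> \<inter> R = {e} then 1 else 0)"
    using fin by (simp flip: sum.inter_filter)
  also have "\<dots> = (\<Sum>R\<in>Pow E. \<Sum>e\<in>E. \<Sum>\<sigma>\<in>T e. if es \<sigma> \<inter> R = {e} then 1 else 0)"
    by (simp only: sum.swap[where B = "Pow E"])
  also have "\<dots> = (\<Sum>R\<in>Pow E. \<Sum>e\<in>E. card (U R e))"
    using finT by (simp add: U_def flip: sum.inter_filter)
  also have "\<dots> = (\<Sum>R\<in>Pow E. \<Sum>e\<in>R. card (U R e))"
  proof (rule sum.cong[OF refl])
    fix R assume "R \<in> Pow E"
    then show "(\<Sum>e\<in>E. card (U R e)) = (\<Sum>e\<in>R. card (U R e))"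
      using fin by (intro sum.mono_neutral_right) (auto simp: U_def card_eq_0_iff)
  qed
  also have "\<dots> \<le> (\<Sum>R\<in>Pow E. rk K)" using U_le by (intro sum_mono) auto
  also have "\<dots> = 2 ^ card E * rk K" using fin by (simp add: card_Pow)
  finally have main: "(\<Sum>e\<in>E. card (T e)) * 2 ^ (card E - m) \<le> 2 ^ card E * rk K"
    by (simp add: sum_distrib_right)
  have eq: "(\<Sum>e\<in>E. rk K - rk {\<sigma>\<in>K. e \<notin> es \<sigma>}) = (\<Sum>e\<in>E. card (T e))"
  proof (rule sum.cong[OF refl])
    show "rk K - rk {\<sigma>\<in>K. e \<notin> es \<sigma>} = card (T e)" for e
      using T(2)[of e] by linarith
  qed
  show ?thesis
  proof (cases "K = {}")
    case True
    then show ?thesis by simp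
  next
    case False
    then obtain \<sigma> where "\<sigma> \<in> K" by blast
    then have "m \<le> card E" using es[of \<sigma>] card_mono[OF fin(2), of "es \<sigma>"] by simp
    then have "2 ^ card E = 2 ^ m * (2::nat) ^ (card E - m)"
      by (simp flip: power_add)
    then have "(\<Sum>e\<in>E. card (T e)) * 2 ^ (card E - m) \<le> (2 ^ m * rk K) * 2 ^ (card E - m)"
      using main by (simp add: mult_ac)
    then show ?thesis unfolding eq by simp
  qed
qed

end

lemma (in vector_space) dim_insert_finite:
  assumes "finite S"
  shows "dim (insert x S) = (if x \<in> span S then dim S else dim S + 1)"
proof (cases "x \<in> span S")
  case True
  then show ?thesis by (metis dim_span span_redundant)
next
  case False
  obtain B where B: "B \<subseteq> S" "independent B" "span S = span B" "dim S = card B"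
    by (metis basis_exists span_mono span_span subset_antisym)
  have "finite B" using B assms finite_subset by blast
  have "independent (insert x B)" using False B by (simp add: independent_insert)
  moreover have "span (insert x B) = span (insert x S)"
    using B by (metis span_insert)
  ultimately have "dim (insert x S) = card (insert x B)"
    by (metis dim_eq_card)
  moreover have "x \<notin> B" using False B span_base by blast
  ultimately show ?thesis using False B \<open>finite B\<close> by simp
qed

lemma (in vector_space) matroid_rank_dim_image: "matroid_rank (\<lambda>A :: 'd set. dim (f ` A))"
proof
  fix A B :: "'d set" and x
  show "dim (f ` {}) = 0" using dim_eq_card_independent[OF independent_empty] by simp
  { assume "finite A"
    then show "dim (f ` insert x A) \<le> dim (f ` A) + 1" "dim (f ` A) \<le> dim (f ` insert x A)"
      by (auto simp: dim_insert_finite) }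
  { assume "finite B" "A \<subseteq> B"
    then have "finite A" "span (f ` A) \<subseteq> span (f ` B)"
      using finite_subset by (blast, intro span_mono image_mono)
    with \<open>finite B\<close> show "dim (f ` insert x B) + dim (f ` A) \<le> dim (f ` insert x A) + dim (f ` B)"
      by (auto simp: dim_insert_finite) }
qed

section \<open>Betti numbers as differences of ranks\<close>

interpretation fn: vector_space "\<lambda>(r::rat) (c::'b \<Rightarrow> rat) x. r * c x"
  by unfold_locales (auto simp: fun_eq_iff algebra_simps)

text \<open>
  A space of rational functions as a module with an explicit carrier. The spaces of chains, of cycles and
  of boundaries all have this form.
\<close>

definition function_module :: "('b \<Rightarrow> rat) set \<Rightarrow> (rat, 'b \<Rightarrow> rat) module" where
  "function_module W =
     \<lparr>carrier = W, mult = undefined, one = undefined,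
      zero = (\<lambda>_. 0), add = (\<lambda>c d \<sigma>. c \<sigma> + d \<sigma>), smult = (\<lambda>r c \<sigma>. r * c \<sigma>)\<rparr>"

lemma function_module_simps [simp]:
  "carrier (function_module W) = W" "zero (function_module W) = 0"
  "add (function_module W) c d = c + d" "smult (function_module W) r c = (\<lambda>\<sigma>. r * c \<sigma>)"
  by (auto simp: function_module_def fun_eq_iff)

lemma vectorspace_function_module:
  assumes "fn.subspace W"
  shows "vectorspace class_ring (function_module W)"
proof (rule vs_criteria[OF class_field])
  let ?V = "function_module W"
  show "\<forall>v\<in>carrier ?V. \<exists>w\<in>carrier ?V. v \<oplus>\<^bsub>?V\<^esub> w = \<zero>\<^bsub>?V\<^esub>"
  proof
    fix v assume "v \<in> carrier ?V"
    then have "- v \<in> W" using assms fn.subspace_neg[of W v] by simp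
    then show "\<exists>w\<in>carrier ?V. v \<oplus>\<^bsub>?V\<^esub> w = \<zero>\<^bsub>?V\<^esub>"
      by (intro bexI[of _ "- v"]) simp_all
  qed
qed (use fn.subspace_0[OF assms] fn.subspace_add[OF assms] fn.subspace_scale[OF assms]
      in \<open>simp_all add: fun_eq_iff distrib_left distrib_right\<close>)

lemma lincomb_function_module:
  assumes "fn.subspace W" "finite A" "A \<subseteq> W"
  shows "module.lincomb (function_module W) a A = (\<Sum>v\<in>A. (\<lambda>\<sigma>. a v * v \<sigma>))"
proof -
  interpret V: vectorspace class_ring "function_module W"
    by (rule vectorspace_function_module[OF assms(1)])
  show ?thesis using assms(2,3)
  proof (induction A rule: finite_induct)
    case empty
    then show ?case by (simp add: V.lincomb_def)
  next
    case (insert x A)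
    then show ?case
      using V.lincomb_insert2[of A a x] by simp
  qed
qed

text \<open>
  This translates dimensions of modules with a carrier into ranks of families of functions.
\<close>

lemma function_module_dim:
  assumes "finite B"
  shows "vectorspace.dim class_ring (function_module (fn.span B)) = fn.dim B"
    and "vectorspace.fin_dim class_ring (function_module (fn.span B))"
proof -
  let ?W = "fn.span B"
  interpret V: vectorspace class_ring "function_module ?W"
    by (rule vectorspace_function_module) simp
  obtain C where C: "C \<subseteq> B" "fn.independent C" "fn.span B = fn.span C" "fn.dim B = card C"
    by (metis fn.basis_exists fn.span_mono fn.span_span subset_antisym)
  have fin: "finite C" using C assms finite_subset by blast
  have CW: "C \<subseteq> ?W" using C fn.span_superset by blast
  have lc: "module.lincomb (function_module ?W) a C = (\<Sum>v\<in>C. (\<lambda>\<sigma>. a v * v \<sigma>))" for a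
    by (rule lincomb_function_module) (use fin CW in auto)
  have "V.lin_indpt C"
  proof (rule V.finite_lin_indpt2[OF fin])
    show "C \<subseteq> carrier (function_module ?W)" using CW by simp
    fix a assume "V.lincomb a C = \<zero>\<^bsub>function_module ?W\<^esub>"
    then have "(\<Sum>v\<in>C. (\<lambda>\<sigma>. a v * v \<sigma>)) = 0" using lc by simp
    then show "\<forall>v\<in>C. a v = \<zero>\<^bsub>class_ring\<^esub>"
      using C(2) fin unfolding fn.dependent_finite[OF fin] by auto
  qed
  moreover have "V.span C = ?W"
  proof -
    have "V.span C = {V.lincomb a C | a. a \<in> C \<rightarrow> carrier class_ring}"
      by (rule V.finite_span) (use fin CW in auto)
    also have "\<dots> = fn.span C"
      unfolding lc fn.span_finite[OF fin] by auto
    finally show ?thesis using C by simp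
  qed
  ultimately have b: "V.basis C" unfolding V.basis_def using CW by simp
  show "V.dim = fn.dim B" using V.dim_basis[OF fin b] C by simp
  show "V.fin_dim" unfolding V.fin_dim_def using fin b unfolding V.basis_def by blast
qed

lemma function_module_rank_nullity:
  assumes W: "fn.subspace W" "vectorspace.fin_dim class_ring (function_module W)"
    and T: "Vector_Spaces.linear (\<lambda>(r::rat) (c::'b \<Rightarrow> rat) x. r * c x) (\<lambda>r (c::'d \<Rightarrow> rat) x. r * c x) T"
  shows "vectorspace.dim class_ring (function_module (T ` W)) +
    vectorspace.dim class_ring (function_module {c \<in> W. T c = 0}) =
    vectorspace.dim class_ring (function_module W)"
proof -
  interpret T: Vector_Spaces.linear "\<lambda>(r::rat) (c::'b \<Rightarrow> rat) x. r * c x" "\<lambda>r (c::'d \<Rightarrow> rat) x. r * c x" T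
    by (rule T)
  interpret V: vectorspace class_ring "function_module W"
    by (rule vectorspace_function_module) (rule W)
  interpret U: vectorspace class_ring "function_module (UNIV :: ('d \<Rightarrow> rat) set)"
    by (rule vectorspace_function_module) (rule fn.subspace_UNIV)
  interpret L: linear_map class_ring "function_module W" "function_module (UNIV :: ('d \<Rightarrow> rat) set)" T
    by unfold_locales (auto simp: module_hom_def T.add T.scale)
  have "U.vs (T ` W) = function_module (T ` W)" "V.vs {c \<in> W. T c = 0} = function_module {c \<in> W. T c = 0}"
    by (simp_all add: function_module_def)
  then show ?thesis
    using L.rank_nullity[OF W(2)] by (simp add: L.im_def L.ker_def)
qed

text \<open>
  The canonical projection onto the quotient is linear and surjective with kernel \<open>B\<close>, so this is
  rank--nullity. That the quotient is a vector space follows by carrying the axioms along the projection.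
\<close>

lemma quotient_space_dim:
  fixes Z :: "('b \<Rightarrow> rat) set"
  assumes Z: "fn.subspace Z" "vectorspace.fin_dim class_ring (function_module Z)"
    and B: "fn.subspace B" "B \<subseteq> Z"
  shows "vectorspace.dim class_ring (quotient_space (function_module Z) B) +
    vectorspace.dim class_ring (function_module B) = vectorspace.dim class_ring (function_module Z)"
proof -
  let ?M = "function_module Z" and ?Q = "quotient_space (function_module Z) B"
  define T where "T c = B +>\<^bsub>?M\<^esub> c" for c
  have T_alt: "T c = (\<lambda>b. b + c) ` B" for c
    unfolding T_def a_r_coset_def' by (simp add: UNION_singleton_eq_range)
  have T_iff: "d \<in> T c \<longleftrightarrow> d - c \<in> B" for c d
  proof
    assume "d - c \<in> B"
    then have "(d - c) + c \<in> T c" unfolding T_alt by (rule imageI)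
    then show "d \<in> T c" by simp
  qed (auto simp: T_alt)
  have T_eq: "T c = T d" if "c - d \<in> B" for c d
  proof -
    have "x - c \<in> B \<longleftrightarrow> x - d \<in> B" for x
    proof
      show "x - d \<in> B" if "x - c \<in> B"
        using fn.subspace_add[OF B(1) that \<open>c - d \<in> B\<close>] by simp
      show "x - c \<in> B" if "x - d \<in> B"
        using fn.subspace_diff[OF B(1) that \<open>c - d \<in> B\<close>] by simp
    qed
    then show ?thesis by (simp only: Set.set_eq_iff T_iff simp_thms)
  qed
  have carr: "carrier ?Q = T ` Z"
    by (auto simp: quotient_space_def A_RCOSETS_def' T_def)
  have zero: "zero ?Q = T 0" by (simp add: quotient_space_def T_alt)
  have add: "T c \<oplus>\<^bsub>?Q\<^esub> T d = T (c + d)" for c d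
  proof -
    have "T c \<oplus>\<^bsub>?Q\<^esub> T d = {x + y | x y. x \<in> T c \<and> y \<in> T d}"
      by (auto simp: quotient_space_def set_add_def')
    also have "\<dots> = T (c + d)"
    proof safe
      fix x y assume "x \<in> T c" "y \<in> T d"
      then show "x + y \<in> T (c + d)"
        using fn.subspace_add[OF B(1), of "x - c" "y - d"] by (simp add: T_iff algebra_simps)
    next
      fix z assume "z \<in> T (c + d)"
      then show "\<exists>x y. z = x + y \<and> x \<in> T c \<and> y \<in> T d"
        using fn.subspace_0[OF B(1)]
        by (intro exI[of _ "z - d"] exI[of _ d]) (simp add: T_iff algebra_simps)
    qed
    finally show ?thesis .
  qed
  have smult: "r \<odot>\<^bsub>?Q\<^esub> T c = T (\<lambda>x. r * c x)" for r c
  proof -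
    have "r \<odot>\<^bsub>?Q\<^esub> T c = (\<Union>d\<in>T c. T (\<lambda>x. r * d x))"
      by (auto simp: quotient_space_def T_def)
    also have "T (\<lambda>x. r * d x) = T (\<lambda>x. r * c x)" if "d \<in> T c" for d
    proof (rule T_eq)
      have "(\<lambda>x. r * (d - c) x) \<in> B" using that fn.subspace_scale[OF B(1)] by (simp only: T_iff)
      then show "(\<lambda>x. r * d x) - (\<lambda>x. r * c x) \<in> B"
        by (simp add: fun_diff_def right_diff_distrib)
    qed
    then have "(\<Union>d\<in>T c. T (\<lambda>x. r * d x)) = (\<Union>d\<in>T c. T (\<lambda>x. r * c x))" by auto
    also have "\<dots> = T (\<lambda>x. r * c x)"
      using T_iff[of c c] fn.subspace_0[OF B(1)] by auto
    finally show ?thesis .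
  qed
  interpret V: vectorspace class_ring ?M
    by (rule vectorspace_function_module) (rule Z)
  note Z_add = fn.subspace_add[OF Z(1)] and Z_scale = fn.subspace_scale[OF Z(1)]
    and Z_neg = fn.subspace_neg[OF Z(1)] and Z_0 = fn.subspace_0[OF Z(1)]
  have ring: "a \<oplus>\<^bsub>class_ring\<^esub> b = a + b" "a \<otimes>\<^bsub>class_ring\<^esub> b = a * b" "\<one>\<^bsub>class_ring\<^esub> = (1::rat)" for a b :: rat
    by simp_all
  have "vectorspace class_ring ?Q"
  proof (rule vs_criteria[OF class_field])
    show "\<zero>\<^bsub>?Q\<^esub> \<in> carrier ?Q" unfolding carr zero by (rule imageI[OF Z_0])
    show "\<forall>v w. v \<in> carrier ?Q \<and> w \<in> carrier ?Q \<longrightarrow> v \<oplus>\<^bsub>?Q\<^esub> w \<in> carrier ?Q"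
      unfolding carr by (auto simp only: add intro!: imageI Z_add)
    show "\<forall>v\<in>carrier ?Q. \<exists>w\<in>carrier ?Q. v \<oplus>\<^bsub>?Q\<^esub> w = \<zero>\<^bsub>?Q\<^esub>"
    proof
      fix v assume "v \<in> carrier ?Q"
      then obtain c where c: "c \<in> Z" "v = T c" by (auto simp: carr)
      show "\<exists>w\<in>carrier ?Q. v \<oplus>\<^bsub>?Q\<^esub> w = \<zero>\<^bsub>?Q\<^esub>"
        unfolding carr zero c(2) by (intro bexI[of _ "T (- c)"] imageI Z_neg c(1)) (simp only: add right_minus)
    qed
    show "\<forall>r v. r \<in> carrier class_ring \<and> v \<in> carrier ?Q \<longrightarrow> r \<odot>\<^bsub>?Q\<^esub> v \<in> carrier ?Q"
      unfolding carr by (auto simp only: smult intro!: imageI Z_scale)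
    show "\<forall>v w. v \<in> carrier ?Q \<and> w \<in> carrier ?Q \<longrightarrow> v \<oplus>\<^bsub>?Q\<^esub> w = w \<oplus>\<^bsub>?Q\<^esub> v"
      unfolding carr by (auto simp only: add add.commute)
    show "\<forall>u v w. u \<in> carrier ?Q \<and> v \<in> carrier ?Q \<and> w \<in> carrier ?Q \<longrightarrow>
        (u \<oplus>\<^bsub>?Q\<^esub> v) \<oplus>\<^bsub>?Q\<^esub> w = u \<oplus>\<^bsub>?Q\<^esub> (v \<oplus>\<^bsub>?Q\<^esub> w)"
      unfolding carr by (auto simp only: add add.assoc)
    show "\<forall>v\<in>carrier ?Q. v \<oplus>\<^bsub>?Q\<^esub> \<zero>\<^bsub>?Q\<^esub> = v"
      unfolding carr zero by (auto simp only: add add_0_right)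
    show "\<forall>r s v. r \<in> carrier class_ring \<and> s \<in> carrier class_ring \<and> v \<in> carrier ?Q \<longrightarrow>
        (r \<otimes>\<^bsub>class_ring\<^esub> s) \<odot>\<^bsub>?Q\<^esub> v = r \<odot>\<^bsub>?Q\<^esub> (s \<odot>\<^bsub>?Q\<^esub> v)"
      unfolding carr by (auto simp only: smult ring mult.assoc)
    show "\<forall>v\<in>carrier ?Q. \<one>\<^bsub>class_ring\<^esub> \<odot>\<^bsub>?Q\<^esub> v = v"
      unfolding carr by (auto simp only: smult ring mult_1_left)
    show "\<forall>r s v. r \<in> carrier class_ring \<and> s \<in> carrier class_ring \<and> v \<in> carrier ?Q \<longrightarrow>
        (r \<oplus>\<^bsub>class_ring\<^esub> s) \<odot>\<^bsub>?Q\<^esub> v = (r \<odot>\<^bsub>?Q\<^esub> v) \<oplus>\<^bsub>?Q\<^esub> (s \<odot>\<^bsub>?Q\<^esub> v)"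
      unfolding carr by (auto simp only: smult add ring plus_fun_def distrib_right)
    show "\<forall>r v w. r \<in> carrier class_ring \<and> v \<in> carrier ?Q \<and> w \<in> carrier ?Q \<longrightarrow>
        r \<odot>\<^bsub>?Q\<^esub> (v \<oplus>\<^bsub>?Q\<^esub> w) = (r \<odot>\<^bsub>?Q\<^esub> v) \<oplus>\<^bsub>?Q\<^esub> (r \<odot>\<^bsub>?Q\<^esub> w)"
      unfolding carr by (auto simp only: smult add ring plus_fun_def distrib_left)
  qed
  then interpret Q: vectorspace class_ring ?Q .
  interpret L: linear_map class_ring ?M ?Q T
    by unfold_locales (auto simp: module_hom_def add smult carr)
  have "{c \<in> Z. T c = \<zero>\<^bsub>?Q\<^esub>} = B"
  proof -
    have "T c = T 0 \<longleftrightarrow> c \<in> B" for c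
      using T_iff[of c c] T_iff[of c 0] T_eq[of c 0] fn.subspace_0[OF B(1)]
      by (metis diff_self diff_zero)
    then show ?thesis using B(2) by (auto simp only: zero)
  qed
  moreover have "V.vs B = function_module B" by (simp add: function_module_def)
  moreover have "Q.vs (T ` Z) = ?Q" by (simp flip: carr)
  ultimately show ?thesis
    using L.rank_nullity[OF Z(2)] by (simp add: L.im_def L.ker_def)
qed

text \<open>
  The image of a single oriented simplex under the boundary map. It does not depend on the complex, so
  that ranks for different graphs can be compared.
\<close>

definition simplex_boundary :: "'a::linorder set \<Rightarrow> 'a set \<Rightarrow> rat" where
  "simplex_boundary \<sigma> \<tau> = (\<Sum>v\<in>\<sigma>. if \<tau> = \<sigma> - {v} then (-1) ^ card {u \<in> \<sigma>. u < v} else 0)"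

lemma sum_fun_apply: "(\<Sum>i\<in>A. f i) x = (\<Sum>i\<in>A. f i x)"
  by (induction A rule: infinite_finite_induct) simp_all

lemma boundary_apply:
  assumes "k > 0"
  shows "boundary k X c \<tau> = (\<Sum>\<sigma>\<in>faces k X. c \<sigma> * simplex_boundary \<sigma> \<tau>)"
proof -
  have "k \<noteq> 0" using assms by simp
  then show ?thesis
    unfolding boundary_def simplex_boundary_def sum_distrib_left if_not_P[OF \<open>k \<noteq> 0\<close>]
    by (intro sum.cong refl) simp
qed

lemma facet_sign_antisym:
  fixes v w :: "'a::linorder"
  assumes "finite \<sigma>" "v \<in> \<sigma>" "w \<in> \<sigma>" "v < w"
  shows "(-1) ^ card {u \<in> \<sigma>. u < v} * (-1) ^ card {u \<in> \<sigma> - {v}. u < w} =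
    - ((-1) ^ card {u \<in> \<sigma>. u < w} * (-1) ^ card {u \<in> \<sigma> - {w}. u < v} :: rat)"
proof -
  have "{u \<in> \<sigma> - {w}. u < v} = {u \<in> \<sigma>. u < v}" using assms by auto
  moreover have "{u \<in> \<sigma>. u < w} = insert v {u \<in> \<sigma> - {v}. u < w}" using assms by auto
  then have "card {u \<in> \<sigma>. u < w} = Suc (card {u \<in> \<sigma> - {v}. u < w})" using assms by simp
  ultimately show ?thesis by simp
qed

text \<open>
  This is the identity \<open>\<partial>\<partial> = 0\<close> for one simplex: the terms that delete the vertices \<open>v, w\<close> in the two
  possible orders cancel.
\<close>

lemma sum_boundaries_of_facets_eq_0:
  fixes \<sigma> :: "'a::linorder set"
  assumes "finite \<sigma>"
  shows "(\<Sum>v\<in>\<sigma>. (-1) ^ card {u \<in> \<sigma>. u < v} * simplex_boundary (\<sigma> - {v}) \<tau>) = 0"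
proof -
  define g :: "'a \<Rightarrow> 'a \<Rightarrow> rat" where "g v w = (if \<tau> = \<sigma> - {v} - {w} then
      (-1) ^ card {u \<in> \<sigma>. u < v} * (-1) ^ card {u \<in> \<sigma> - {v}. u < w} else 0)" for v w
  have anti: "g v w = - g w v" if "v \<in> \<sigma>" "w \<in> \<sigma>" "v \<noteq> w" for v w
  proof -
    have "\<sigma> - {v} - {w} = \<sigma> - {w} - {v}" by auto
    then show ?thesis
      using facet_sign_antisym[OF assms that(1,2)] facet_sign_antisym[OF assms that(2,1)] that(3)
      by (cases v w rule: linorder_cases) (auto simp: g_def)
  qed
  have "(\<Sum>v\<in>\<sigma>. (-1) ^ card {u \<in> \<sigma>. u < v} * simplex_boundary (\<sigma> - {v}) \<tau>) = (\<Sum>v\<in>\<sigma>. \<Sum>w\<in>\<sigma> - {v}. g v w)"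
    unfolding simplex_boundary_def sum_distrib_left g_def by (intro sum.cong refl) auto
  also have "\<dots> = (\<Sum>(v, w)\<in>(SIGMA v:\<sigma>. \<sigma> - {v}). g v w)"
    using assms by (simp add: sum.Sigma)
  finally have eq: "(\<Sum>v\<in>\<sigma>. (-1) ^ card {u \<in> \<sigma>. u < v} * simplex_boundary (\<sigma> - {v}) \<tau>) = \<dots>" .
  have "(\<Sum>(v, w)\<in>(SIGMA v:\<sigma>. \<sigma> - {v}). g v w) = (\<Sum>(v, w)\<in>(SIGMA v:\<sigma>. \<sigma> - {v}). g w v)"
    by (rule sum.reindex_bij_witness[of _ prod.swap prod.swap]) auto
  also have "\<dots> = (\<Sum>(v, w)\<in>(SIGMA v:\<sigma>. \<sigma> - {v}). - g v w)"
    by (rule sum.cong) (auto intro: anti)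
  also have "\<dots> = - (\<Sum>(v, w)\<in>(SIGMA v:\<sigma>. \<sigma> - {v}). g v w)"
    by (simp add: sum_negf case_prod_unfold)
  finally show ?thesis unfolding eq by simp
qed

locale finite_complex =
  fixes X :: "'a::linorder set set"
  assumes finite_faces: "finite (faces k X)"
    and face_finite: "\<sigma> \<in> X \<Longrightarrow> finite \<sigma>"
    and face_subset: "\<sigma> \<in> X \<Longrightarrow> \<tau> \<subseteq> \<sigma> \<Longrightarrow> \<tau> \<noteq> {} \<Longrightarrow> \<tau> \<in> X"
begin

lemma facet_in_faces:
  assumes "\<sigma> \<in> faces (Suc k) X" "v \<in> \<sigma>"
  shows "\<sigma> - {v} \<in> faces k X"
proof -
  have \<sigma>: "\<sigma> \<in> X" "card \<sigma> = Suc (Suc k)" "finite \<sigma>"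
    using assms face_finite by (auto simp: faces_def)
  then have card: "card (\<sigma> - {v}) = Suc k" using assms by simp
  then have "\<sigma> - {v} \<noteq> {}" by force
  then show ?thesis using \<sigma> card face_subset[of \<sigma> "\<sigma> - {v}"] by (simp add: faces_def)
qed

lemma simplex_boundary_supported:
  assumes "\<sigma> \<in> faces (Suc k) X" "simplex_boundary \<sigma> \<tau> \<noteq> 0"
  shows "\<tau> \<in> faces k X"
proof -
  obtain v where "v \<in> \<sigma>" "\<tau> = \<sigma> - {v}"
    using assms(2) unfolding simplex_boundary_def
    by (elim sum.not_neutral_contains_not_neutral) (simp split: if_splits)
  then show ?thesis using facet_in_faces[OF assms(1)] by simp
qed

lemma boundary_of_simplex_boundary:
  assumes "k > 0" "\<sigma> \<in> faces (Suc k) X"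
  shows "boundary k X (simplex_boundary \<sigma>) = 0"
proof
  fix \<tau>
  have fin: "finite \<sigma>" using assms face_finite by (auto simp: faces_def)
  have "boundary k X (simplex_boundary \<sigma>) \<tau> = (\<Sum>\<rho>\<in>faces k X. \<Sum>v\<in>\<sigma>. if \<rho> = \<sigma> - {v} then
      (-1) ^ card {u \<in> \<sigma>. u < v} * simplex_boundary \<rho> \<tau> else 0)"
    unfolding boundary_apply[OF assms(1)] simplex_boundary_def[of \<sigma>] sum_distrib_right
    by (intro sum.cong refl) auto
  also have "\<dots> = (\<Sum>v\<in>\<sigma>. \<Sum>\<rho>\<in>faces k X. if \<rho> = \<sigma> - {v} then
      (-1) ^ card {u \<in> \<sigma>. u < v} * simplex_boundary \<rho> \<tau> else 0)"
    by (rule sum.swap)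
  also have "\<dots> = (\<Sum>v\<in>\<sigma>. (-1) ^ card {u \<in> \<sigma>. u < v} * simplex_boundary (\<sigma> - {v}) \<tau>)"
    using facet_in_faces[OF assms(2)] finite_faces by (intro sum.cong refl) (simp add: sum.delta)
  also have "\<dots> = 0" using sum_boundaries_of_facets_eq_0[OF fin] .
  finally show "boundary k X (simplex_boundary \<sigma>) \<tau> = 0 \<tau>" by simp
qed

definition chains :: "nat \<Rightarrow> ('a set \<Rightarrow> rat) set" where
  "chains k = {c. \<forall>\<sigma>. c \<sigma> \<noteq> 0 \<longrightarrow> \<sigma> \<in> faces k X}"

definition elementary_chain :: "'a set \<Rightarrow> 'a set \<Rightarrow> rat" where
  "elementary_chain \<sigma> = (\<lambda>\<tau>. if \<tau> = \<sigma> then 1 else 0)"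

lemma chains_eq_span: "chains k = fn.span (elementary_chain ` faces k X)"
proof
  show "chains k \<subseteq> fn.span (elementary_chain ` faces k X)"
  proof
    fix c assume c: "c \<in> chains k"
    have "c = (\<Sum>\<sigma>\<in>faces k X. (\<lambda>\<tau>. c \<sigma> * elementary_chain \<sigma> \<tau>))"
    proof
      fix \<tau>
      have "(\<Sum>\<sigma>\<in>faces k X. (\<lambda>\<tau>. c \<sigma> * elementary_chain \<sigma> \<tau>)) \<tau> =
          (\<Sum>\<sigma>\<in>faces k X. c \<sigma> * elementary_chain \<sigma> \<tau>)"
        by (rule sum_fun_apply)
      also have "\<dots> = (\<Sum>\<sigma>\<in>faces k X. if \<tau> = \<sigma> then c \<sigma> else 0)"
        by (intro sum.cong refl) (simp add: elementary_chain_def)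
      also have "\<dots> = c \<tau>"
        using c finite_faces by (auto simp: chains_def)
      finally show "c \<tau> = (\<Sum>\<sigma>\<in>faces k X. (\<lambda>\<tau>. c \<sigma> * elementary_chain \<sigma> \<tau>)) \<tau>" by simp
    qed
    also have "\<dots> \<in> fn.span (elementary_chain ` faces k X)"
      by (intro fn.span_sum fn.span_scale fn.span_base imageI)
    finally show "c \<in> fn.span (elementary_chain ` faces k X)" .
  qed
  have "fn.subspace (chains k)"
    by (rule fn.subspaceI) (auto simp: chains_def, metis add_0)
  then show "fn.span (elementary_chain ` faces k X) \<subseteq> chains k"
    by (rule fn.span_minimal[rotated]) (auto simp: chains_def elementary_chain_def split: if_splits)
qed

lemma dim_elementary_chains: "fn.dim (elementary_chain ` faces k X) = card (faces k X)"
proof -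
  let ?B = "elementary_chain ` faces k X"
  have inj: "inj elementary_chain"
    by (rule injI) (metis elementary_chain_def zero_neq_one)
  have fin: "finite ?B" using finite_faces by simp
  have "fn.independent ?B"
  proof
    assume "fn.dependent ?B"
    then obtain u where u: "\<exists>v\<in>?B. u v \<noteq> 0" "(\<Sum>v\<in>?B. (\<lambda>\<tau>. u v * v \<tau>)) = 0"
      unfolding fn.dependent_finite[OF fin] by blast
    have "u (elementary_chain \<tau>) = 0" if "\<tau> \<in> faces k X" for \<tau>
    proof -
      have "0 = (\<Sum>v\<in>?B. (\<lambda>\<tau>. u v * v \<tau>)) \<tau>" using u(2) by simp
      also have "\<dots> = (\<Sum>v\<in>?B. u v * v \<tau>)" by (rule sum_fun_apply)
      also have "\<dots> = (\<Sum>\<sigma>\<in>faces k X. u (elementary_chain \<sigma>) * elementary_chain \<sigma> \<tau>)"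
        using inj by (subst sum.reindex) (auto intro: inj_on_subset)
      also have "\<dots> = (\<Sum>\<sigma>\<in>faces k X. if \<tau> = \<sigma> then u (elementary_chain \<sigma>) else 0)"
        by (intro sum.cong refl) (simp add: elementary_chain_def)
      also have "\<dots> = u (elementary_chain \<tau>)" using that finite_faces by simp
      finally show ?thesis by simp
    qed
    with u(1) show False by auto
  qed
  then show ?thesis
    using inj by (simp add: fn.dim_eq_card_independent card_image inj_on_subset)
qed

lemma linear_boundary:
  assumes "k > 0"
  shows "Vector_Spaces.linear (\<lambda>(r::rat) (c::'a set \<Rightarrow> rat) x. r * c x) (\<lambda>r c x. r * c x) (boundary k X)"
proof unfold_locales
  show "boundary k X (c + d) = boundary k X c + boundary k X d" for c d
    by (rule ext) (simp add: boundary_apply[OF assms] sum.distrib distrib_right)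
  show "boundary k X (\<lambda>\<sigma>. r * c \<sigma>) = (\<lambda>\<sigma>. r * boundary k X c \<sigma>)" for r c
    by (rule ext) (simp add: boundary_apply[OF assms] sum_distrib_left mult.assoc)
qed

lemma boundary_image_chains:
  assumes "k > 0"
  shows "boundary k X ` chains k = fn.span (simplex_boundary ` faces k X)"
proof -
  interpret pair: vector_space_pair "\<lambda>(r::rat) (c::'a set \<Rightarrow> rat) x. r * c x" "\<lambda>(r::rat) (c::'a set \<Rightarrow> rat) x. r * c x"
    ..
  have "boundary k X (elementary_chain \<sigma>) = simplex_boundary \<sigma>" if "\<sigma> \<in> faces k X" for \<sigma>
  proof
    fix \<tau>
    have "boundary k X (elementary_chain \<sigma>) \<tau> = (\<Sum>\<rho>\<in>faces k X. if \<rho> = \<sigma> then simplex_boundary \<rho> \<tau> else 0)"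
      unfolding boundary_apply[OF assms] by (intro sum.cong refl) (simp add: elementary_chain_def)
    also have "\<dots> = simplex_boundary \<sigma> \<tau>" using that finite_faces by simp
    finally show "boundary k X (elementary_chain \<sigma>) \<tau> = simplex_boundary \<sigma> \<tau>" .
  qed
  then have "boundary k X ` elementary_chain ` faces k X = simplex_boundary ` faces k X"
    by (simp add: image_image)
  then show ?thesis
    using pair.linear_span_image[OF linear_boundary[OF assms]] unfolding chains_eq_span by metis
qed

text \<open>
  Rank--nullity for \<open>\<partial>\<^sub>k\<close> gives the dimension of the space of cycles, and the dimension of the space of
  boundaries is the rank of \<open>\<partial>\<^sub>k\<^sub>+\<^sub>1\<close>. The formulation with sums avoids truncated subtraction.
\<close>

theorem betti_eq:
  assumes "k > 0"
  shows "betti k X + fn.dim (simplex_boundary ` faces k X) + fn.dim (simplex_boundary ` faces (k + 1) X) = card (faces k X)"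
proof -
  let ?Z = "{c \<in> chains k. boundary k X c = 0}" and ?B = "fn.span (simplex_boundary ` faces (k + 1) X)"
  have cs: "chain_space j X = function_module (chains j)" for j
    by (simp add: chain_space_def function_module_def chains_def)
  have zs: "cycle_space k X = function_module ?Z"
    by (simp add: cycle_space_def chain_space_def function_module_def chains_def zero_fun_def)
  have bs: "boundaries k X = ?B"
    using boundary_image_chains[of "k + 1"] by (simp add: boundaries_def cs)
  have fin: "finite (elementary_chain ` faces j X)" "finite (simplex_boundary ` faces j X)" for j
    using finite_faces by simp_all
  have C: "fn.subspace (chains k)" "vectorspace.fin_dim class_ring (function_module (chains k))"
      "vectorspace.dim class_ring (function_module (chains k)) = card (faces k X)"
    unfolding chains_eq_span using function_module_dim[OF fin(1)[of k]] dim_elementary_chains by simp_all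
  interpret L: Vector_Spaces.linear "\<lambda>(r::rat) (c::'a set \<Rightarrow> rat) x. r * c x" "\<lambda>(r::rat) (c::'a set \<Rightarrow> rat) x. r * c x"
    "boundary k X" by (rule linear_boundary[OF assms])
  have "fn.subspace {c. boundary k X c = 0}" by (rule L.subspace_kernel)
  from fn.subspace_inter[OF C(1) this] have Z: "fn.subspace ?Z"
    by (rule back_subst[of fn.subspace]) auto
  have BZ: "?B \<subseteq> ?Z"
  proof (rule fn.span_minimal[OF _ Z])
    show "simplex_boundary ` faces (k + 1) X \<subseteq> ?Z"
      using boundary_of_simplex_boundary[OF assms] simplex_boundary_supported[of _ k] by (auto simp: chains_def)
  qed
  have rank: "fn.dim (simplex_boundary ` faces k X) + vectorspace.dim class_ring (function_module ?Z) = card (faces k X)"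
    using function_module_rank_nullity[OF C(1,2) linear_boundary[OF assms]] C(3)
      function_module_dim(1)[OF fin(2)[of k]] boundary_image_chains[OF assms] by simp
  have Zfin: "vectorspace.fin_dim class_ring (function_module ?Z)"
  proof -
    have "?Z \<subseteq> fn.span (elementary_chain ` faces k X)" using chains_eq_span by auto
    moreover obtain D where D: "D \<subseteq> ?Z" "fn.independent D" "?Z \<subseteq> fn.span D"
      by (rule fn.basis_exists)
    ultimately have "D \<subseteq> fn.span (elementary_chain ` faces k X)" by (meson order_trans)
    then have "finite D" using fn.independent_span_bound[OF fin(1) D(2)] by blast
    moreover have "fn.span D = ?Z" using fn.span_minimal[OF D(1) Z] D(3) by (rule equalityI)
    ultimately show ?thesis using function_module_dim(2)[of D] by simp
  qed
  have "vectorspace.dim class_ring (homology k X) + fn.dim (simplex_boundary ` faces (k + 1) X) =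
      vectorspace.dim class_ring (function_module ?Z)"
    using quotient_space_dim[OF Z Zfin fn.subspace_span BZ] function_module_dim(1)[OF fin(2)[of "k + 1"]]
    by (simp add: homology_def zs bs)
  with rank show ?thesis by (simp add: betti_def)
qed

text \<open>
  The boundaries of \<open>(k+1)\<close>-faces lie in the space of \<open>k\<close>-chains.
\<close>

lemma dim_boundary_faces_le:
  assumes "A \<subseteq> faces (Suc k) X"
  shows "fn.dim (simplex_boundary ` A) \<le> card (faces k X)"
proof -
  have "simplex_boundary \<sigma> \<in> chains k" if "\<sigma> \<in> A" for \<sigma>
    using that assms simplex_boundary_supported[of \<sigma> k] unfolding chains_def by blast
  then have "simplex_boundary ` A \<subseteq> fn.span (elementary_chain ` faces k X)"
    unfolding chains_eq_span by blast
  then show ?thesis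
    using fn.dim_le_card[of "simplex_boundary ` A" "elementary_chain ` faces k X"] finite_faces
      card_image_le[OF finite_faces, of elementary_chain k] by simp
qed

end

section \<open>Random subsets and the Efron--Stein inequality\<close>

text \<open>
  The mean of \<open>f G\<close> for a random subset \<open>G\<close> of \<open>E\<close> that contains every element independently with
  probability \<open>p\<close>. As a finite sum it makes sense for values in any real vector space, in particular
  for real and for complex ones.
\<close>

definition subset_mean :: "'e set \<Rightarrow> real \<Rightarrow> ('e set \<Rightarrow> 'b::real_vector) \<Rightarrow> 'b" where
  "subset_mean E p f = (\<Sum>G\<in>Pow E. (p ^ card G * (1 - p) ^ card (E - G)) *\<^sub>R f G)"

lemma subset_mean_cong: "(\<And>G. G \<subseteq> E \<Longrightarrow> f G = g G) \<Longrightarrow> subset_mean E p f = subset_mean E p g"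
  unfolding subset_mean_def by (intro sum.cong) auto

lemma subset_mean_add: "subset_mean E p (\<lambda>G. f G + g G) = subset_mean E p f + subset_mean E p g"
  by (simp add: subset_mean_def scaleR_add_right sum.distrib)

lemma subset_mean_diff: "subset_mean E p (\<lambda>G. f G - g G) = subset_mean E p f - subset_mean E p g"
  by (simp add: subset_mean_def scaleR_diff_right sum_subtractf)

lemma subset_mean_sum: "subset_mean E p (\<lambda>G. \<Sum>i\<in>I. f i G) = (\<Sum>i\<in>I. subset_mean E p (f i))"
  unfolding subset_mean_def scaleR_sum_right by (rule sum.swap)

lemma subset_mean_cmult: "subset_mean E p (\<lambda>G. c * f G) = c * subset_mean E p f" for c :: "'b::real_algebra"
  by (simp add: subset_mean_def sum_distrib_left)

lemma subset_mean_mono: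
  fixes f g :: "'e set \<Rightarrow> real"
  assumes "0 \<le> p" "p \<le> 1" "\<And>G. G \<subseteq> E \<Longrightarrow> f G \<le> g G"
  shows "subset_mean E p f \<le> subset_mean E p g"
  unfolding subset_mean_def using assms by (intro sum_mono) (auto intro!: mult_left_mono)

lemma norm_subset_mean_le:
  fixes f :: "'e set \<Rightarrow> 'b::real_normed_vector"
  assumes "0 \<le> p" "p \<le> 1"
  shows "norm (subset_mean E p f) \<le> subset_mean E p (\<lambda>G. norm (f G))"
  unfolding subset_mean_def using assms by (intro order_trans[OF norm_sum] sum_mono) simp

lemma subset_mean_insert:
  assumes "finite E" "e \<notin> E"
  shows "subset_mean (insert e E) p f = p *\<^sub>R subset_mean E p (\<lambda>G. f (insert e G)) + (1 - p) *\<^sub>R subset_mean E p f"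
proof -
  have inj: "inj_on (insert e) (Pow E)"
    using assms(2) by (intro inj_onI) (metis PowD insert_ident subsetD)
  have "subset_mean (insert e E) p f =
      (\<Sum>G\<in>Pow E. (p ^ card G * (1 - p) ^ card (insert e E - G)) *\<^sub>R f G) +
      (\<Sum>G\<in>insert e ` Pow E. (p ^ card G * (1 - p) ^ card (insert e E - G)) *\<^sub>R f G)"
    unfolding subset_mean_def Pow_insert using assms by (intro sum.union_disjoint) auto
  also have "(\<Sum>G\<in>insert e ` Pow E. (p ^ card G * (1 - p) ^ card (insert e E - G)) *\<^sub>R f G) =
      (\<Sum>G\<in>Pow E. (p ^ card (insert e G) * (1 - p) ^ card (insert e E - insert e G)) *\<^sub>R f (insert e G))"
    by (rule sum.reindex_cong[OF inj refl]) simp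
  also have "\<dots> = p *\<^sub>R subset_mean E p (\<lambda>G. f (insert e G))"
    unfolding subset_mean_def scaleR_sum_right
  proof (intro sum.cong refl)
    fix G assume "G \<in> Pow E"
    then have "card (insert e G) = Suc (card G)" "insert e E - insert e G = E - G"
      using assms by (auto intro!: card_insert_disjoint intro: finite_subset)
    then show "(p ^ card (insert e G) * (1 - p) ^ card (insert e E - insert e G)) *\<^sub>R f (insert e G) =
        p *\<^sub>R (p ^ card G * (1 - p) ^ card (E - G)) *\<^sub>R f (insert e G)" by simp
  qed
  also have "(\<Sum>G\<in>Pow E. (p ^ card G * (1 - p) ^ card (insert e E - G)) *\<^sub>R f G) = (1 - p) *\<^sub>R subset_mean E p f"
    unfolding subset_mean_def scaleR_sum_right
  proof (intro sum.cong refl)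
    fix G assume "G \<in> Pow E"
    then have "insert e E - G = insert e (E - G)" "e \<notin> E - G" using assms by auto
    then have "card (insert e E - G) = Suc (card (E - G))" using assms by simp
    then show "(p ^ card G * (1 - p) ^ card (insert e E - G)) *\<^sub>R f G =
        (1 - p) *\<^sub>R (p ^ card G * (1 - p) ^ card (E - G)) *\<^sub>R f G" by simp
  qed
  finally show ?thesis by simp
qed

lemma subset_mean_empty: "subset_mean {} p f = f {}"
  by (simp add: subset_mean_def)

lemma subset_mean_const: "finite E \<Longrightarrow> subset_mean E p (\<lambda>_. c) = c"
proof (induction E rule: finite_induct)
  case (insert e E)
  then show ?case by (simp add: subset_mean_insert flip: scaleR_add_left)
qed (simp add: subset_mean_empty)

definition subset_variance :: "'e set \<Rightarrow> real \<Rightarrow> ('e set \<Rightarrow> real) \<Rightarrow> real" where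
  "subset_variance E p f = subset_mean E p (\<lambda>G. (f G - subset_mean E p f)\<^sup>2)"

lemma subset_variance_eq:
  assumes "finite E"
  shows "subset_variance E p f = subset_mean E p (\<lambda>G. (f G)\<^sup>2) - (subset_mean E p f)\<^sup>2"
proof -
  let ?m = "subset_mean E p f"
  have "subset_variance E p f = subset_mean E p (\<lambda>G. (f G)\<^sup>2 - (2 * ?m) * f G + ?m\<^sup>2)"
    unfolding subset_variance_def by (intro subset_mean_cong) (simp add: power2_eq_square algebra_simps)
  also have "\<dots> = subset_mean E p (\<lambda>G. (f G)\<^sup>2) - 2 * ?m * ?m + ?m\<^sup>2"
    unfolding subset_mean_add subset_mean_diff subset_mean_cmult subset_mean_const[OF assms] ..
  finally show ?thesis by (simp add: power2_eq_square)
qed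

lemma subset_mean_nonneg:
  fixes f :: "'e set \<Rightarrow> real"
  assumes "0 \<le> p" "p \<le> 1" "\<And>G. G \<subseteq> E \<Longrightarrow> 0 \<le> f G"
  shows "0 \<le> subset_mean E p f"
  unfolding subset_mean_def using assms by (intro sum_nonneg) auto

lemma subset_variance_nonneg: "0 \<le> p \<Longrightarrow> p \<le> 1 \<Longrightarrow> 0 \<le> subset_variance E p f"
  unfolding subset_variance_def by (intro subset_mean_nonneg) auto

text \<open>
  By induction on \<open>E\<close>: the variance splits into the mean of the conditional variance with respect to a new
  element \<open>e\<close>, which is the summand of \<open>e\<close>, and the variance of the conditional mean \<open>m\<close>. Increments of \<open>m\<close>
  are averages of increments of \<open>f\<close>, so the convexity of the square bounds their second moments.
\<close>

theorem efron_stein: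
  assumes "finite E" "0 \<le> p" "p \<le> 1"
  shows "subset_variance E p f \<le> p * (1 - p) * (\<Sum>e\<in>E. subset_mean E p (\<lambda>G. (f (insert e G) - f (G - {e}))\<^sup>2))"
  using assms(1)
proof (induction E arbitrary: f rule: finite_induct)
  case empty
  then show ?case by (simp add: subset_variance_def subset_mean_empty)
next
  case (insert e E)
  define m where "m G = p * f (insert e G) + (1 - p) * f G" for G
  have "subset_variance (insert e E) p f = subset_variance E p m + p * (1 - p) * subset_mean E p (\<lambda>G. (f (insert e G) - f G)\<^sup>2)"
  proof -
    have sq: "(m G)\<^sup>2 + p * (1 - p) * (f (insert e G) - f G)\<^sup>2 = p * (f (insert e G))\<^sup>2 + (1 - p) * (f G)\<^sup>2" for G
      unfolding m_def by (simp add: power2_eq_square algebra_simps)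
    have mean: "subset_mean (insert e E) p f = subset_mean E p m"
      using insert by (simp add: subset_mean_insert m_def[abs_def] subset_mean_add subset_mean_cmult)
    have "subset_mean (insert e E) p (\<lambda>G. (f G)\<^sup>2) =
        subset_mean E p (\<lambda>G. (m G)\<^sup>2) + p * (1 - p) * subset_mean E p (\<lambda>G. (f (insert e G) - f G)\<^sup>2)"
    proof -
      have "subset_mean (insert e E) p (\<lambda>G. (f G)\<^sup>2) = subset_mean E p (\<lambda>G. p * (f (insert e G))\<^sup>2 + (1 - p) * (f G)\<^sup>2)"
        using insert by (simp add: subset_mean_insert subset_mean_add subset_mean_cmult)
      also have "\<dots> = subset_mean E p (\<lambda>G. (m G)\<^sup>2 + p * (1 - p) * (f (insert e G) - f G)\<^sup>2)"
        by (simp only: sq)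
      finally show ?thesis by (simp only: subset_mean_add subset_mean_cmult)
    qed
    then show ?thesis using insert mean by (simp add: subset_variance_eq)
  qed
  moreover have "subset_variance E p m \<le> p * (1 - p) * (\<Sum>e'\<in>E. subset_mean E p (\<lambda>G. (m (insert e' G) - m (G - {e'}))\<^sup>2))"
    by (rule insert.IH)
  moreover have "subset_mean E p (\<lambda>G. (m (insert e' G) - m (G - {e'}))\<^sup>2) \<le>
      subset_mean (insert e E) p (\<lambda>G. (f (insert e' G) - f (G - {e'}))\<^sup>2)" if e': "e' \<in> E" for e'
  proof -
    have "e \<noteq> e'" using e' insert by auto
    have convex: "(p * x + (1 - p) * y)\<^sup>2 \<le> p * x\<^sup>2 + (1 - p) * y\<^sup>2" for x y :: real
    proof -
      have "p * x\<^sup>2 + (1 - p) * y\<^sup>2 - (p * x + (1 - p) * y)\<^sup>2 = p * (1 - p) * (x - y)\<^sup>2"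
        by (simp add: power2_eq_square algebra_simps)
      then show ?thesis using assms by (smt (verit) mult_nonneg_nonneg zero_le_power2)
    qed
    have "subset_mean E p (\<lambda>G. (m (insert e' G) - m (G - {e'}))\<^sup>2) \<le>
        subset_mean E p (\<lambda>G. p * (f (insert e' (insert e G)) - f (insert e G - {e'}))\<^sup>2 +
          (1 - p) * (f (insert e' G) - f (G - {e'}))\<^sup>2)"
    proof (rule subset_mean_mono[OF assms(2,3)])
      fix G
      have "insert e (G - {e'}) = insert e G - {e'}" "insert e (insert e' G) = insert e' (insert e G)"
        using \<open>e \<noteq> e'\<close> by auto
      then have "m (insert e' G) - m (G - {e'}) =
          p * (f (insert e' (insert e G)) - f (insert e G - {e'})) + (1 - p) * (f (insert e' G) - f (G - {e'}))"
        by (simp add: m_def algebra_simps)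
      then show "(m (insert e' G) - m (G - {e'}))\<^sup>2 \<le>
          p * (f (insert e' (insert e G)) - f (insert e G - {e'}))\<^sup>2 +
          (1 - p) * (f (insert e' G) - f (G - {e'}))\<^sup>2" using convex by simp
    qed
    also have "\<dots> = subset_mean (insert e E) p (\<lambda>G. (f (insert e' G) - f (G - {e'}))\<^sup>2)"
      using insert by (simp add: subset_mean_insert subset_mean_add subset_mean_cmult)
    finally show ?thesis .
  qed
  then have "(\<Sum>e'\<in>E. subset_mean E p (\<lambda>G. (m (insert e' G) - m (G - {e'}))\<^sup>2)) \<le>
      (\<Sum>e'\<in>E. subset_mean (insert e E) p (\<lambda>G. (f (insert e' G) - f (G - {e'}))\<^sup>2))"
    by (rule sum_mono)
  then have "p * (1 - p) * (\<Sum>e'\<in>E. subset_mean E p (\<lambda>G. (m (insert e' G) - m (G - {e'}))\<^sup>2)) \<le>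
      p * (1 - p) * (\<Sum>e'\<in>E. subset_mean (insert e E) p (\<lambda>G. (f (insert e' G) - f (G - {e'}))\<^sup>2))"
    using assms by (intro mult_left_mono) auto
  moreover have "subset_mean (insert e E) p (\<lambda>G. (f (insert e G) - f (G - {e}))\<^sup>2) =
      subset_mean E p (\<lambda>G. (f (insert e G) - f G)\<^sup>2)"
  proof -
    have rem: "G - {e} = G" if "G \<subseteq> E" for G using insert(2) that by auto
    have "subset_mean E p (\<lambda>G. (f (insert e (insert e G)) - f (insert e G - {e}))\<^sup>2) =
        subset_mean E p (\<lambda>G. (f (insert e G) - f G)\<^sup>2)"
      "subset_mean E p (\<lambda>G. (f (insert e G) - f (G - {e}))\<^sup>2) = subset_mean E p (\<lambda>G. (f (insert e G) - f G)\<^sup>2)"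
      using rem by (auto intro!: subset_mean_cong)
    then show ?thesis using insert by (simp add: subset_mean_insert flip: distrib_right)
  qed
  ultimately show ?case using insert(1,2) by (simp add: distrib_left)
qed

lemma subset_mean_superset:
  assumes "finite E" "A \<subseteq> E"
  shows "subset_mean E p (\<lambda>G. if A \<subseteq> G then 1 else 0 :: real) = p ^ card A"
  using assms
proof (induction E arbitrary: A rule: finite_induct)
  case empty
  then show ?case by (simp add: subset_mean_empty)
next
  case (insert e E)
  have "finite A" using insert finite_subset by blast
  show ?case
  proof (cases "e \<in> A")
    case True
    have "subset_mean E p (\<lambda>G. if A \<subseteq> insert e G then 1 else 0 :: real) = p ^ card (A - {e})"
    proof -
      have "subset_mean E p (\<lambda>G. if A \<subseteq> insert e G then 1 else 0 :: real) = subset_mean E p (\<lambda>G. if A - {e} \<subseteq> G then 1 else 0)"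
        by (intro subset_mean_cong) (auto simp: subset_insert_iff)
      then show ?thesis using insert by (auto intro!: insert.IH)
    qed
    moreover have "subset_mean E p (\<lambda>G. if A \<subseteq> G then 1 else 0 :: real) = subset_mean E p (\<lambda>_. 0)"
      using True insert by (intro subset_mean_cong) auto
    moreover have "card A = Suc (card (A - {e}))" using True \<open>finite A\<close> by (metis card_Suc_Diff1)
    ultimately show ?thesis using insert by (simp add: subset_mean_insert subset_mean_const)
  next
    case False
    then have "A \<subseteq> E" using insert by auto
    moreover have "subset_mean E p (\<lambda>G. if A \<subseteq> insert e G then 1 else 0 :: real) = subset_mean E p (\<lambda>G. if A \<subseteq> G then 1 else 0)"
      using False by (intro subset_mean_cong) auto
    ultimately show ?thesis using insert by (simp add: subset_mean_insert flip: distrib_right)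
  qed
qed

text \<open>
  A statistic that ignores \<open>e\<close> is independent of the event that \<open>e\<close> is chosen.
\<close>

lemma subset_mean_if_mem:
  assumes "finite E" "e \<in> E" "\<And>G. G \<subseteq> E \<Longrightarrow> g (insert e G) = g (G - {e})"
  shows "subset_mean E p (\<lambda>G. if e \<in> G then g G else 0 :: real) = p * subset_mean E p g"
proof -
  obtain E' where E': "E = insert e E'" "e \<notin> E'" using assms(2) by (metis mk_disjoint_insert)
  then have "finite E'" using assms(1) by simp
  have "g (insert e G) = g G" if "G \<subseteq> E'" for G
  proof -
    have "G - {e} = G" "G \<subseteq> E" using that E' by auto
    then show ?thesis using assms(3)[of G] by simp
  qed
  then have "subset_mean E' p (\<lambda>G. g (insert e G)) = subset_mean E' p g" by (intro subset_mean_cong)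
  moreover have "subset_mean E' p (\<lambda>G. if e \<in> G then g G else 0) = subset_mean E' p (\<lambda>_. 0)"
    using E' by (intro subset_mean_cong) auto
  ultimately show ?thesis
    using \<open>finite E'\<close> E' by (simp add: subset_mean_insert subset_mean_const flip: distrib_right)
qed

lemma subset_mean_power_card:
  fixes z :: "'b::real_normed_field"
  assumes "finite E"
  shows "subset_mean E p (\<lambda>G. z ^ card G) = (of_real p * z + of_real (1 - p)) ^ card E"
  using assms
proof (induction E rule: finite_induct)
  case (insert e E)
  have "subset_mean E p (\<lambda>G. z ^ card (insert e G)) = subset_mean E p (\<lambda>G. z * z ^ card G)"
    using insert by (intro subset_mean_cong) (auto simp: card_insert_if finite_subset)
  then show ?case using insert
    by (simp add: subset_mean_insert subset_mean_cmult algebra_simps scaleR_conv_of_real)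
qed (simp add: subset_mean_empty)

definition random_subset :: "'e set \<Rightarrow> real \<Rightarrow> 'e set pmf" where
  "random_subset E p = map_pmf (\<lambda>\<omega>. {e \<in> E. \<omega> e}) (Pi_pmf E False (\<lambda>_. bernoulli_pmf p))"

lemma expectation_random_subset:
  fixes f :: "'e set \<Rightarrow> 'b::{banach, second_countable_topology}"
  assumes "finite E" "0 \<le> p" "p \<le> 1"
  shows "measure_pmf.expectation (random_subset E p) f = subset_mean E p f"
proof -
  let ?P = "Pi_pmf E False (\<lambda>_. bernoulli_pmf p)" and ?ind = "\<lambda>G e. e \<in> G"
  have inj: "inj_on ?ind (Pow E)"
    by (intro inj_onI) (auto simp: fun_eq_iff)
  have "set_pmf ?P \<subseteq> ?ind ` Pow E"
  proof
    fix \<omega> assume "\<omega> \<in> set_pmf ?P"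
    then have "\<And>e. e \<notin> E \<Longrightarrow> \<not> \<omega> e"
      using set_Pi_pmf_subset[OF assms(1), of False "\<lambda>_. bernoulli_pmf p"] by auto
    then have "\<omega> = ?ind {e \<in> E. \<omega> e}" by auto
    then show "\<omega> \<in> ?ind ` Pow E" by (rule image_eqI) auto
  qed
  then have "measure_pmf.expectation (random_subset E p) f =
      (\<Sum>\<omega>\<in>?ind ` Pow E. pmf ?P \<omega> *\<^sub>R f {e \<in> E. \<omega> e})"
    unfolding random_subset_def integral_map_pmf
    using assms(1) by (intro integral_measure_pmf) auto
  also have "\<dots> = (\<Sum>G\<in>Pow E. pmf ?P (?ind G) *\<^sub>R f {e \<in> E. e \<in> G})"
    by (simp add: sum.reindex[OF inj])
  also have "\<dots> = subset_mean E p f"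
    unfolding subset_mean_def
  proof (intro sum.cong refl)
    fix G assume "G \<in> Pow E"
    then have G: "G \<subseteq> E" "{e \<in> E. e \<in> G} = G" "E \<inter> {e. e \<in> G} = G" "E \<inter> - {e. e \<in> G} = E - G" by auto
    have "pmf ?P (?ind G) = (\<Prod>e\<in>E. pmf (bernoulli_pmf p) (e \<in> G))"
      using assms(1) G by (intro pmf_Pi') auto
    also have "\<dots> = (\<Prod>e\<in>E. if e \<in> G then p else 1 - p)"
      using assms by (intro prod.cong) auto
    also have "\<dots> = p ^ card G * (1 - p) ^ card (E - G)"
      using assms(1) G(3,4) by (simp add: prod.If_cases)
    finally show "pmf ?P (?ind G) *\<^sub>R f {e \<in> E. e \<in> G} = (p ^ card G * (1 - p) ^ card (E - G)) *\<^sub>R f G"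
      using G by simp
  qed
  finally show ?thesis .
qed

section \<open>A central limit theorem for almost linear statistics of random subsets\<close>

text \<open>
  Here \<open>z\<close> is the characteristic function of one centered Bernoulli variable after division by the
  standard deviation \<open>s\<close> of the sum of \<open>N\<close> copies. In the Taylor expansion of order two the linear
  terms cancel and the quadratic ones add up to \<open>t\<^sup>2 / N\<close>.
\<close>

lemma binomial_char_factor:
  fixes p s t :: real and N :: nat
  assumes p: "0 \<le> p" "p \<le> 1" and s: "s > 0" and N: "N > 0" "s\<^sup>2 = real N * p * (1 - p)"
  defines "z \<equiv> complex_of_real p * iexp (t * ((1 - p) / s)) + complex_of_real (1 - p) * iexp (t * (- p / s))"
  shows "cmod z \<le> 1" and "cmod (z - complex_of_real (1 - t\<^sup>2 / (2 * real N))) \<le> \<bar>t\<bar> ^ 3 / (6 * real N * s)"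
proof -
  let ?a = "t * ((1 - p) / s)" and ?b = "t * (- p / s)"
  let ?r = "\<lambda>x. iexp x - (\<Sum>k\<le>2. (\<i> * complex_of_real x) ^ k / fact k)"
  show "cmod z \<le> 1"
  proof -
    have "cmod z \<le> cmod (complex_of_real p * iexp ?a) + cmod (complex_of_real (1 - p) * iexp ?b)"
      unfolding z_def by (rule norm_triangle_ineq)
    also have "\<dots> = \<bar>p\<bar> + \<bar>1 - p\<bar>" by (simp add: norm_mult del: of_real_diff)
    finally show ?thesis using p by simp
  qed
  have expand: "(\<Sum>k\<le>2. (\<i> * complex_of_real x) ^ k / fact k) = 1 + \<i> * x - x\<^sup>2 / 2" for x
    by (simp add: numeral_2_eq_2 power2_eq_square algebra_simps)
  have "p * ?a + (1 - p) * ?b = 0" using s by (simp add: field_simps)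
  moreover have "p * ?a\<^sup>2 + (1 - p) * ?b\<^sup>2 = t\<^sup>2 / N"
  proof -
    have "p * ?a\<^sup>2 + (1 - p) * ?b\<^sup>2 = t\<^sup>2 * (p * (1 - p)) / s\<^sup>2"
      using s by (simp add: field_simps power2_eq_square)
    moreover have "p * (1 - p) = s\<^sup>2 / N" using N by simp
    ultimately show ?thesis using s by simp
  qed
  ultimately have eq: "complex_of_real p * (1 + \<i> * ?a - ?a\<^sup>2 / 2) + complex_of_real (1 - p) * (1 + \<i> * ?b - ?b\<^sup>2 / 2) =
      complex_of_real (1 - t\<^sup>2 / (2 * real N))"
  proof -
    assume 1: "p * ?a + (1 - p) * ?b = 0" and 2: "p * ?a\<^sup>2 + (1 - p) * ?b\<^sup>2 = t\<^sup>2 / N"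
    have "p * (1 - a / 2) + (1 - p) * (1 - b / 2) = 1 - (p * a + (1 - p) * b) / 2" for a b
      by (simp add: field_simps)
    then have "p * (1 - ?a\<^sup>2 / 2) + (1 - p) * (1 - ?b\<^sup>2 / 2) = 1 - (p * ?a\<^sup>2 + (1 - p) * ?b\<^sup>2) / 2" .
    also have "\<dots> = 1 - t\<^sup>2 / (2 * real N)" unfolding 2 by simp
    finally show ?thesis using 1 by (simp add: complex_eq_iff)
  qed
  have "z - complex_of_real (1 - t\<^sup>2 / (2 * real N)) = complex_of_real p * ?r ?a + complex_of_real (1 - p) * ?r ?b"
    unfolding z_def expand eq[symmetric] by (simp add: ring_distribs del: of_real_diff of_real_mult)
  also have "cmod \<dots> \<le> p * cmod (?r ?a) + (1 - p) * cmod (?r ?b)"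
    using p by (intro order_trans[OF norm_triangle_ineq]) (simp add: norm_mult del: of_real_diff)
  also have "\<dots> \<le> p * (\<bar>?a\<bar> ^ 3 / 6) + (1 - p) * (\<bar>?b\<bar> ^ 3 / 6)"
  proof -
    have r: "cmod (?r x) \<le> \<bar>x\<bar> ^ 3 / 6" for x
      using iexp_approx1[of x 2] by (simp add: fact_numeral eval_nat_numeral)
    show ?thesis using p by (intro add_mono mult_left_mono r) simp_all
  qed
  also have "\<dots> = \<bar>t\<bar> ^ 3 / (6 * s ^ 3) * (p * (1 - p)) * ((1 - p)\<^sup>2 + p\<^sup>2)"
  proof -
    have abs: "\<bar>?a\<bar> = \<bar>t\<bar> * (1 - p) / s" "\<bar>?b\<bar> = \<bar>t\<bar> * p / s" using p s by (simp_all add: abs_mult)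
    have "p * (T * q ^ 3 / S / 6) + q * (T * p ^ 3 / S / 6) = T / (6 * S) * (p * q) * (q\<^sup>2 + p\<^sup>2)" for T S q :: real
      by (simp add: power2_eq_square power3_eq_cube distrib_left add_divide_distrib mult_ac)
    then show ?thesis unfolding abs power_divide power_mult_distrib .
  qed
  also have "\<dots> \<le> \<bar>t\<bar> ^ 3 / (6 * s ^ 3) * (p * (1 - p)) * 1"
  proof (rule mult_left_mono)
    have "(1 - p)\<^sup>2 + p\<^sup>2 = 1 - 2 * (p * (1 - p))" by (simp add: power2_eq_square algebra_simps)
    then show "(1 - p)\<^sup>2 + p\<^sup>2 \<le> 1" using p by simp
  qed (use p s in auto)
  also have "\<dots> = \<bar>t\<bar> ^ 3 / (6 * real N * s)"
  proof -
    have pq: "p * (1 - p) = s\<^sup>2 / N" using N by simp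
    show ?thesis unfolding pq using s N(1) by (simp add: power2_eq_square power3_eq_cube mult_ac)
  qed
  finally show "cmod (z - complex_of_real (1 - t\<^sup>2 / (2 * real N))) \<le> \<bar>t\<bar> ^ 3 / (6 * real N * s)" .
qed

lemma char_standardized_card:
  assumes "finite E"
  shows "subset_mean E p (\<lambda>G. iexp (t * ((real (card G) - real (card E) * p) / s))) =
    (complex_of_real p * iexp (t * ((1 - p) / s)) + complex_of_real (1 - p) * iexp (t * (- p / s))) ^ card E"
proof -
  let ?N = "card E"
  have "iexp (t * ((real (card G) - real ?N * p) / s)) = iexp (t * (- p / s)) ^ ?N * iexp (t / s) ^ card G" for G :: "'a set"
  proof -
    have "\<i> * complex_of_real (t * ((real (card G) - real ?N * p) / s)) =
        of_nat ?N * (\<i> * complex_of_real (t * (- p / s))) + of_nat (card G) * (\<i> * complex_of_real (t / s))"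
      by (simp add: diff_divide_distrib algebra_simps)
    then show ?thesis by (simp only: exp_add exp_of_nat_mult)
  qed
  then have "subset_mean E p (\<lambda>G. iexp (t * ((real (card G) - real ?N * p) / s))) =
      iexp (t * (- p / s)) ^ ?N * (of_real p * iexp (t / s) + of_real (1 - p)) ^ ?N"
    using assms by (simp only: subset_mean_cmult subset_mean_power_card)
  also have "\<dots> = (iexp (t * (- p / s)) * (of_real p * iexp (t / s) + of_real (1 - p))) ^ ?N"
    by (simp only: power_mult_distrib)
  also have "iexp (t * (- p / s)) * (of_real p * iexp (t / s) + of_real (1 - p)) =
      complex_of_real p * iexp (t * ((1 - p) / s)) + complex_of_real (1 - p) * iexp (t * (- p / s))"
  proof -
    have "\<i> * complex_of_real (t * ((1 - p) / s)) = \<i> * complex_of_real (t * (- p / s)) + \<i> * complex_of_real (t / s)"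
      by (simp add: diff_divide_distrib algebra_simps)
    then have "iexp (t * ((1 - p) / s)) = iexp (t * (- p / s)) * iexp (t / s)"
      by (simp only: exp_add)
    then show ?thesis by (simp only: distrib_left mult_ac)
  qed
  finally show ?thesis .
qed

text \<open>
  The probability may vary with \<open>n\<close>, as long as the variance tends to infinity. The powers \<open>z\<^sup>N\<close> and
  \<open>w\<^sup>N\<close> of numbers in the unit disc differ by at most \<open>N\<close> times the difference of \<open>z\<close> and \<open>w\<close>,
  which reduces the claim to the limit of \<open>(1 - t\<^sup>2 / (2 N))\<^sup>N\<close>.
\<close>

lemma de_moivre_laplace:
  fixes E :: "nat \<Rightarrow> 'e set"
  assumes fin: "\<And>n. finite (E n)" and p: "\<And>n. 0 \<le> p n \<and> p n \<le> 1"
    and lim: "filterlim (\<lambda>n. real (card (E n)) * p n * (1 - p n)) at_top sequentially"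
  shows "(\<lambda>n. subset_mean (E n) (p n) (\<lambda>G. iexp (t * ((real (card G) - real (card (E n)) * p n) /
      sqrt (real (card (E n)) * p n * (1 - p n)))))) \<longlonglongrightarrow> complex_of_real (exp (- t\<^sup>2 / 2))"
proof -
  define N where "N n = card (E n)" for n
  define s where "s n = sqrt (real (N n) * p n * (1 - p n))" for n
  define z where "z n = complex_of_real (p n) * iexp (t * ((1 - p n) / s n)) +
    complex_of_real (1 - p n) * iexp (t * (- p n / s n))" for n
  define w where "w n = complex_of_real (1 - t\<^sup>2 / (2 * real (N n)))" for n
  have s_lim: "filterlim s at_top sequentially"
    unfolding s_def N_def by (rule filterlim_compose[OF sqrt_at_top lim])
  have "real (N n) * p n * (1 - p n) \<le> real (N n)" for n
    using p[of n] by (intro order_trans[OF mult_mono[of "real (N n) * p n" "real (N n)" "1 - p n" 1]])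
      (auto simp: mult_left_le)
  then have N_lim: "filterlim (\<lambda>n. real (N n)) at_top sequentially"
    using lim unfolding N_def by (auto intro: filterlim_at_top_mono)
  have ev: "\<forall>\<^sub>F n in sequentially. cmod (z n ^ N n - w n ^ N n) \<le> \<bar>t\<bar> ^ 3 / 6 / s n"
    using filterlim_at_top_dense[THEN iffD1, OF s_lim, rule_format, of 0]
      filterlim_at_top_dense[THEN iffD1, OF N_lim, rule_format, of "max 0 (t\<^sup>2)"]
  proof eventually_elim
    case (elim n)
    have "0 < real (N n)" using le_less_trans[OF max.cobounded1 elim(2)] .
    with elim have N: "N n > 0" and s: "s n > 0" by auto
    have s2: "(s n)\<^sup>2 = real (N n) * p n * (1 - p n)"
      using p[of n] by (simp add: s_def)
    have "cmod (z n) \<le> 1" "cmod (z n - w n) \<le> \<bar>t\<bar> ^ 3 / (6 * real (N n) * s n)"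
      unfolding z_def w_def using binomial_char_factor[OF conjunct1[OF p] conjunct2[OF p] s N s2] by blast+
    moreover have "cmod (w n) \<le> 1"
    proof -
      have "0 \<le> t\<^sup>2 / (2 * real (N n))" "t\<^sup>2 / (2 * real (N n)) \<le> 1" using elim N by (auto simp: field_simps)
      then show ?thesis unfolding w_def norm_of_real by simp
    qed
    ultimately have "cmod (z n ^ N n - w n ^ N n) \<le> N n * (\<bar>t\<bar> ^ 3 / (6 * real (N n) * s n))"
      by (meson norm_power_diff order_trans mult_left_mono of_nat_0_le_iff)
    also have "\<dots> = \<bar>t\<bar> ^ 3 / 6 / s n" using N by simp
    finally show ?case .
  qed
  have "(\<lambda>n. \<bar>t\<bar> ^ 3 / 6 / s n) \<longlonglongrightarrow> 0"
    by (rule tendsto_divide_0[OF tendsto_const filterlim_at_top_imp_at_infinity[OF s_lim]])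
  then have "(\<lambda>n. z n ^ N n - w n ^ N n) \<longlonglongrightarrow> 0"
    by (rule Lim_null_comparison[OF ev])
  moreover have "(\<lambda>n. w n ^ N n) \<longlonglongrightarrow> complex_of_real (exp (- t\<^sup>2 / 2))"
  proof -
    have "filterlim N at_top sequentially"
      unfolding filterlim_at_top
    proof
      fix Z
      have "\<forall>\<^sub>F n in sequentially. real Z \<le> real (N n)"
        using N_lim unfolding filterlim_at_top by blast
      then show "\<forall>\<^sub>F n in sequentially. Z \<le> N n" by simp
    qed
    then have "(\<lambda>n. (1 + (- t\<^sup>2 / 2) / real (N n)) ^ N n) \<longlonglongrightarrow> exp (- t\<^sup>2 / 2)"
      by (rule filterlim_compose[OF tendsto_exp_limit_sequentially])
    then have "(\<lambda>n. (1 - t\<^sup>2 / (2 * real (N n))) ^ N n) \<longlonglongrightarrow> exp (- t\<^sup>2 / 2)" by simp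
    then show ?thesis unfolding w_def of_real_power[symmetric] by (rule tendsto_of_real)
  qed
  ultimately have "(\<lambda>n. (z n ^ N n - w n ^ N n) + w n ^ N n) \<longlonglongrightarrow> 0 + complex_of_real (exp (- t\<^sup>2 / 2))"
    by (rule tendsto_add)
  then show ?thesis
    by (simp only: char_standardized_card[OF fin] z_def s_def N_def diff_add_cancel add_0_left)
qed

lemma norm_iexp_diff_le: "cmod (iexp a - iexp b) \<le> \<bar>a - b\<bar>"
proof -
  have "\<i> * complex_of_real a = \<i> * complex_of_real b + \<i> * complex_of_real (a - b)"
    by (simp add: algebra_simps)
  then have "iexp a - iexp b = iexp b * (iexp (a - b) - 1)"
    by (simp only: exp_add right_diff_distrib mult_1_right)
  then have "cmod (iexp a - iexp b) = cmod (iexp (a - b) - 1)"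
    by (simp only: norm_mult norm_exp_i_times mult_1_left)
  also have "\<dots> \<le> \<bar>a - b\<bar>"
    using iexp_approx1[of "a - b" 0] by simp
  finally show ?thesis .
qed

lemma subset_mean_iexp_diff_le:
  fixes Y Z :: "'e set \<Rightarrow> real"
  assumes "finite E" "0 \<le> p" "p \<le> 1"
  shows "cmod (subset_mean E p (\<lambda>G. iexp (t * Y G)) - subset_mean E p (\<lambda>G. iexp (t * Z G))) \<le>
    \<bar>t\<bar> * sqrt (subset_mean E p (\<lambda>G. (Y G - Z G)\<^sup>2))"
proof -
  have "cmod (subset_mean E p (\<lambda>G. iexp (t * Y G)) - subset_mean E p (\<lambda>G. iexp (t * Z G))) \<le>
      subset_mean E p (\<lambda>G. cmod (iexp (t * Y G) - iexp (t * Z G)))"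
    unfolding subset_mean_diff[symmetric] by (rule norm_subset_mean_le[OF assms(2,3)])
  also have "\<dots> \<le> subset_mean E p (\<lambda>G. \<bar>t\<bar> * \<bar>Y G - Z G\<bar>)"
  proof (rule subset_mean_mono[OF assms(2,3)])
    show "cmod (iexp (t * Y G) - iexp (t * Z G)) \<le> \<bar>t\<bar> * \<bar>Y G - Z G\<bar>" for G
      using norm_iexp_diff_le[of "t * Y G" "t * Z G"] by (simp only: right_diff_distrib[symmetric] abs_mult)
  qed
  also have "\<dots> = \<bar>t\<bar> * subset_mean E p (\<lambda>G. \<bar>Y G - Z G\<bar>)" by (rule subset_mean_cmult)
  also have "subset_mean E p (\<lambda>G. \<bar>Y G - Z G\<bar>) \<le> sqrt (subset_mean E p (\<lambda>G. (Y G - Z G)\<^sup>2))"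
  proof (rule real_le_rsqrt)
    show "(subset_mean E p (\<lambda>G. \<bar>Y G - Z G\<bar>))\<^sup>2 \<le> subset_mean E p (\<lambda>G. (Y G - Z G)\<^sup>2)"
      using subset_variance_nonneg[OF assms(2,3), of E "\<lambda>G. \<bar>Y G - Z G\<bar>"] subset_variance_eq[OF assms(1)] by simp
  qed
  finally show ?thesis by (simp add: mult_left_mono)
qed

lemma subset_variance_card:
  assumes "finite E"
  shows "subset_mean E p (\<lambda>G. real (card G)) = real (card E) * p"
    and "subset_variance E p (\<lambda>G. real (card G)) = real (card E) * p * (1 - p)"
proof -
  have "subset_mean E p (\<lambda>G. real (card G)) = real (card E) * p \<and>
      subset_mean E p (\<lambda>G. (real (card G))\<^sup>2) = real (card E) * p * (1 - p) + (real (card E) * p)\<^sup>2"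
    using assms
  proof (induction E rule: finite_induct)
    case empty
    then show ?case by (simp add: subset_mean_empty)
  next
    case (insert e E)
    have c: "card (insert e G) = Suc (card G)" if "G \<subseteq> E" for G
      using insert that by (intro card_insert_disjoint) (auto intro: finite_subset)
    have "subset_mean E p (\<lambda>G. real (card (insert e G))) = subset_mean E p (\<lambda>G. real (card G) + 1)"
      by (intro subset_mean_cong) (simp add: c)
    then have 1: "subset_mean E p (\<lambda>G. real (card (insert e G))) = subset_mean E p (\<lambda>G. real (card G)) + 1"
      using insert(1) by (simp only: subset_mean_add subset_mean_const)
    have "subset_mean E p (\<lambda>G. (real (card (insert e G)))\<^sup>2) =
        subset_mean E p (\<lambda>G. (real (card G))\<^sup>2 + (2 * real (card G) + 1))"
      by (intro subset_mean_cong) (simp add: c power2_eq_square algebra_simps)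
    then have 2: "subset_mean E p (\<lambda>G. (real (card (insert e G)))\<^sup>2) =
        subset_mean E p (\<lambda>G. (real (card G))\<^sup>2) + (2 * subset_mean E p (\<lambda>G. real (card G)) + 1)"
      using insert(1) by (simp only: subset_mean_add subset_mean_cmult subset_mean_const)
    have IH: "subset_mean E p (\<lambda>G. real (card G)) = real (card E) * p"
      "subset_mean E p (\<lambda>G. (real (card G))\<^sup>2) = real (card E) * p * (1 - p) + (real (card E) * p)\<^sup>2"
      using insert.IH by auto
    show ?case unfolding subset_mean_insert[OF insert(1,2)] 1 2 IH card_insert_disjoint[OF insert(1,2)]
      by (simp add: power2_eq_square algebra_simps)
  qed
  then show "subset_mean E p (\<lambda>G. real (card G)) = real (card E) * p"
    "subset_variance E p (\<lambda>G. real (card G)) = real (card E) * p * (1 - p)"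
    using subset_variance_eq[OF assms] by simp_all
qed

text \<open>
  Let \<open>F\<close> be the centered \<open>f\<close>, let \<open>C\<close> be \<open>\<mu>\<close> times the centered cardinality, and \<open>s', s\<close> their
  \<open>L\<^sup>2\<close>-norms. By polarization the unit vectors \<open>F / s'\<close> and \<open>C / s\<close> satisfy
  \<open>\<parallel>F / s' - C / s\<parallel>\<^sup>2 \<le> \<parallel>F - C\<parallel>\<^sup>2 / (s' s)\<close>, and \<open>s' \<ge> s / 2\<close> as \<open>F\<close> and \<open>C\<close> are close.
\<close>

lemma standardized_distance:
  fixes f :: "'e set \<Rightarrow> real"
  assumes fin: "finite E" and p: "0 \<le> p" "p \<le> 1" and \<mu>: "\<mu> > 0"
    and \<sigma>: "\<sigma> > 0" "\<sigma>\<^sup>2 = real (card E) * p * (1 - p)"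
    and \<rho>: "subset_variance E p (\<lambda>G. f G - \<mu> * real (card G)) \<le> \<rho> * (\<mu> * \<sigma>)\<^sup>2" "\<rho> \<le> 1 / 4"
  shows "subset_mean E p (\<lambda>G. ((f G - subset_mean E p f) / sqrt (subset_variance E p f) - (real (card G) - real (card E) * p) / \<sigma>)\<^sup>2) \<le> 2 * \<rho>"
proof -
  define F where "F G = f G - subset_mean E p f" for G
  define C where "C G = \<mu> * (real (card G) - real (card E) * p)" for G :: "'e set"
  define s where "s = \<mu> * \<sigma>"
  define v where "v = subset_mean E p (\<lambda>G. (F G)\<^sup>2)"
  have s: "s > 0" using \<mu> \<sigma> by (simp add: s_def)
  have v: "subset_variance E p f = v" by (simp add: v_def subset_variance_def F_def)
  have EC: "subset_mean E p (\<lambda>G. (C G)\<^sup>2) = s\<^sup>2"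
  proof -
    have "subset_mean E p (\<lambda>G. (C G)\<^sup>2) = \<mu>\<^sup>2 * subset_variance E p (\<lambda>G. real (card G))"
      unfolding C_def power_mult_distrib subset_mean_cmult subset_variance_def subset_variance_card(1)[OF fin] ..
    also have "\<dots> = s\<^sup>2" unfolding subset_variance_card(2)[OF fin] s_def power_mult_distrib \<sigma>(2) ..
    finally show ?thesis .
  qed
  have ER: "subset_mean E p (\<lambda>G. (F G - C G)\<^sup>2) \<le> \<rho> * s\<^sup>2"
  proof -
    have mean: "subset_mean E p (\<lambda>G. f G - \<mu> * real (card G)) = subset_mean E p f - \<mu> * (real (card E) * p)"
      unfolding subset_mean_diff subset_mean_cmult subset_variance_card(1)[OF fin] ..
    have "subset_variance E p (\<lambda>G. f G - \<mu> * real (card G)) = subset_mean E p (\<lambda>G. (F G - C G)\<^sup>2)"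
      unfolding subset_variance_def mean by (intro subset_mean_cong) (simp add: F_def C_def algebra_simps)
    then show ?thesis using \<rho>(1) by (simp add: s_def)
  qed
  have "s\<^sup>2 \<le> 2 * v + 2 * (\<rho> * s\<^sup>2)"
  proof -
    have "s\<^sup>2 \<le> subset_mean E p (\<lambda>G. 2 * (F G)\<^sup>2 + 2 * (F G - C G)\<^sup>2)"
      unfolding EC[symmetric]
    proof (rule subset_mean_mono[OF p])
      fix G
      have "2 * (F G)\<^sup>2 + 2 * (F G - C G)\<^sup>2 - (C G)\<^sup>2 = (2 * F G - C G)\<^sup>2"
        by (simp add: power2_eq_square algebra_simps)
      then show "(C G)\<^sup>2 \<le> 2 * (F G)\<^sup>2 + 2 * (F G - C G)\<^sup>2"
        using zero_le_power2[of "2 * F G - C G"] by linarith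
    qed
    also have "\<dots> = 2 * v + 2 * subset_mean E p (\<lambda>G. (F G - C G)\<^sup>2)"
      unfolding subset_mean_add subset_mean_cmult v_def ..
    finally show ?thesis using ER by linarith
  qed
  moreover have "\<rho> * s\<^sup>2 \<le> 1 / 4 * s\<^sup>2" using \<rho>(2) by (intro mult_right_mono) auto
  ultimately have v_ge: "(s / 2)\<^sup>2 \<le> v" by (simp add: power_divide)
  define s' where "s' = sqrt v"
  have s'_ge: "s / 2 \<le> s'" unfolding s'_def by (rule real_le_rsqrt[OF v_ge])
  have "0 < (s / 2)\<^sup>2" using s by simp
  then have "v > 0" using v_ge by linarith
  then have s': "s' > 0" "s'\<^sup>2 = v" by (simp_all add: s'_def)
  \<comment> \<open>polarization\<close>
  have cross: "subset_mean E p (\<lambda>G. F G * C G) = (v + s\<^sup>2 - subset_mean E p (\<lambda>G. (F G - C G)\<^sup>2)) / 2"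
  proof -
    have "subset_mean E p (\<lambda>G. (F G - C G)\<^sup>2) = subset_mean E p (\<lambda>G. (F G)\<^sup>2 + (C G)\<^sup>2 - 2 * (F G * C G))"
      by (intro subset_mean_cong) (simp add: power2_eq_square algebra_simps)
    then show ?thesis unfolding subset_mean_add subset_mean_diff subset_mean_cmult EC v_def by simp
  qed
  have "subset_mean E p (\<lambda>G. (F G / s' - C G / s)\<^sup>2) = subset_mean E p (\<lambda>G. (1 / s'\<^sup>2) * (F G)\<^sup>2 + (1 / s\<^sup>2) * (C G)\<^sup>2 - (2 / (s' * s)) * (F G * C G))"
    using s s'(1) by (intro subset_mean_cong) (simp add: power2_eq_square field_simps)
  also have "\<dots> = (1 / s'\<^sup>2) * v + (1 / s\<^sup>2) * s\<^sup>2 - (2 / (s' * s)) * ((v + s\<^sup>2 - subset_mean E p (\<lambda>G. (F G - C G)\<^sup>2)) / 2)"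
    unfolding subset_mean_add subset_mean_diff subset_mean_cmult EC cross v_def ..
  also have "\<dots> = 2 - (v + s\<^sup>2 - subset_mean E p (\<lambda>G. (F G - C G)\<^sup>2)) / (s' * s)"
  proof -
    have "(1 / s'\<^sup>2) * s'\<^sup>2 + (1 / s\<^sup>2) * s\<^sup>2 - (2 / (s' * s)) * (X / 2) = 2 - X / (s' * s)" for X
      using s s'(1) by simp
    then show ?thesis unfolding s'(2) .
  qed
  also have "\<dots> \<le> 2 - (2 * (s' * s) - \<rho> * s\<^sup>2) / (s' * s)"
  proof -
    have "v + s\<^sup>2 - 2 * (s' * s) = (s' - s)\<^sup>2" unfolding s'(2)[symmetric] by (simp add: power2_eq_square algebra_simps)
    then have "2 * (s' * s) - \<rho> * s\<^sup>2 \<le> v + s\<^sup>2 - subset_mean E p (\<lambda>G. (F G - C G)\<^sup>2)"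
      using ER zero_le_power2[of "s' - s"] by linarith
    then show ?thesis using s s' by (intro diff_left_mono divide_right_mono) auto
  qed
  also have "\<dots> = \<rho> * (s / s')" using s s'(1) by (simp add: field_simps power2_eq_square)
  also have "\<dots> \<le> \<rho> * 2"
  proof (rule mult_left_mono)
    show "s / s' \<le> 2" using s'_ge s' by (simp add: field_simps)
    have "0 \<le> \<rho> * s\<^sup>2" using ER subset_mean_nonneg[OF p, of E "\<lambda>G. (F G - C G)\<^sup>2"] by simp
    then show "0 \<le> \<rho>" using s by (simp add: zero_le_mult_iff)
  qed
  finally have "subset_mean E p (\<lambda>G. (F G / s' - C G / s)\<^sup>2) \<le> 2 * \<rho>" by simp
  moreover have "F G / s' - C G / s = (f G - subset_mean E p f) / sqrt (subset_variance E p f) - (real (card G) - real (card E) * p) / \<sigma>" for G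
    using \<mu> by (simp add: F_def s'_def v C_def s_def)
  ultimately show ?thesis by simp
qed

text \<open>
  A statistic that is close to a multiple of the cardinality, measured on the scale of the standard
  deviation of that multiple, has the same normal limit. Both standardizations are close in \<open>L\<^sup>2\<close>, hence so
  are their characteristic functions.
\<close>

theorem clt_of_linear_approximation:
  fixes E :: "nat \<Rightarrow> 'e set" and f :: "nat \<Rightarrow> 'e set \<Rightarrow> real"
  assumes fin: "\<And>n. finite (E n)" and p: "\<And>n. 0 \<le> p n \<and> p n \<le> 1"
    and lim: "filterlim (\<lambda>n. real (card (E n)) * p n * (1 - p n)) at_top sequentially"
    and \<mu>: "\<forall>\<^sub>F n in sequentially. \<mu> n > 0"
    and bound: "\<forall>\<^sub>F n in sequentially. subset_variance (E n) (p n) (\<lambda>G. f n G - \<mu> n * real (card G)) \<le>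
      \<rho> n * ((\<mu> n)\<^sup>2 * (real (card (E n)) * p n * (1 - p n)))"
    and \<rho>: "\<rho> \<longlonglongrightarrow> 0"
  shows "weak_conv_m
    (\<lambda>n. distr (measure_pmf (random_subset (E n) (p n))) borel
      (\<lambda>G. (f n G - subset_mean (E n) (p n) (f n)) / sqrt (subset_variance (E n) (p n) (f n))))
    std_normal_distribution"
proof (rule levy_continuity)
  define \<sigma> where "\<sigma> n = sqrt (real (card (E n)) * p n * (1 - p n))" for n
  define Y where "Y n G = (f n G - subset_mean (E n) (p n) (f n)) / sqrt (subset_variance (E n) (p n) (f n))" for n G
  define Z where "Z n G = (real (card G) - real (card (E n)) * p n) / \<sigma> n" for n and G :: "'e set"
  fix t :: real
  show "(\<lambda>n. char (distr (measure_pmf (random_subset (E n) (p n))) borel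
      (\<lambda>G. (f n G - subset_mean (E n) (p n) (f n)) / sqrt (subset_variance (E n) (p n) (f n)))) t)
    \<longlonglongrightarrow> char std_normal_distribution t"
  proof -
    have char_eq: "char (distr (measure_pmf (random_subset (E n) (p n))) borel (Y n)) t =
        subset_mean (E n) (p n) (\<lambda>G. iexp (t * Y n G))" for n
      unfolding char_def by (subst integral_distr) (auto simp: expectation_random_subset fin p)
    have Z_lim: "(\<lambda>n. subset_mean (E n) (p n) (\<lambda>G. iexp (t * Z n G))) \<longlonglongrightarrow> complex_of_real (exp (- t\<^sup>2 / 2))"
      unfolding Z_def \<sigma>_def by (rule de_moivre_laplace[OF fin p lim])
    have "\<forall>\<^sub>F n in sequentially. \<rho> n < 1 / 4" by (rule order_tendstoD(2)[OF \<rho>]) simp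
    moreover have "\<forall>\<^sub>F n in sequentially. real (card (E n)) * p n * (1 - p n) > 0"
      using lim unfolding filterlim_at_top_dense by blast
    ultimately have "\<forall>\<^sub>F n in sequentially.
        cmod (subset_mean (E n) (p n) (\<lambda>G. iexp (t * Y n G)) - subset_mean (E n) (p n) (\<lambda>G. iexp (t * Z n G))) \<le> \<bar>t\<bar> * sqrt (2 * \<rho> n)"
      using \<mu> bound
    proof eventually_elim
      case (elim n)
      have \<sigma>: "\<sigma> n > 0" "(\<sigma> n)\<^sup>2 = real (card (E n)) * p n * (1 - p n)"
        using elim by (simp_all add: \<sigma>_def)
      have "subset_mean (E n) (p n) (\<lambda>G. (Y n G - Z n G)\<^sup>2) \<le> 2 * \<rho> n"
        unfolding Y_def Z_def using elim fin p
        by (intro standardized_distance[OF fin _ _ _ \<sigma>, of "\<mu> n"]) (auto simp: power_mult_distrib \<sigma>(2))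
      then have "\<bar>t\<bar> * sqrt (subset_mean (E n) (p n) (\<lambda>G. (Y n G - Z n G)\<^sup>2)) \<le> \<bar>t\<bar> * sqrt (2 * \<rho> n)"
        by (intro mult_left_mono) auto
      then show ?case
        using subset_mean_iexp_diff_le[OF fin conjunct1[OF p] conjunct2[OF p]] order_trans by blast
    qed
    moreover have "(\<lambda>n. \<bar>t\<bar> * sqrt (2 * \<rho> n)) \<longlonglongrightarrow> 0"
      using tendsto_mult[OF tendsto_const tendsto_real_sqrt[OF tendsto_mult[OF tendsto_const \<rho>]], of "\<bar>t\<bar>" 2] by simp
    ultimately have "(\<lambda>n. subset_mean (E n) (p n) (\<lambda>G. iexp (t * Y n G)) - subset_mean (E n) (p n) (\<lambda>G. iexp (t * Z n G))) \<longlonglongrightarrow> 0"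
      by (rule Lim_null_comparison)
    from tendsto_add[OF this Z_lim]
    have "(\<lambda>n. char (distr (measure_pmf (random_subset (E n) (p n))) borel (Y n)) t) \<longlonglongrightarrow> complex_of_real (exp (- t\<^sup>2 / 2))"
      by (simp add: char_eq)
    then show ?thesis
      unfolding char_std_normal_distribution Y_def by simp
  qed
next
  show "real_distribution (distr (measure_pmf (random_subset (E n) (p n))) borel
      (\<lambda>G. (f n G - subset_mean (E n) (p n) (f n)) / sqrt (subset_variance (E n) (p n) (f n))))" for n
    by (rule prob_space.real_distribution_distr) (auto intro: measure_pmf.prob_space_axioms)
  show "real_distribution std_normal_distribution"
    by (rule real_dist_normal_dist)
qed

section \<open>Moments of clique counts\<close>

definition edges_of :: "'a set \<Rightarrow> 'a set set" where
  "edges_of \<sigma> = {e. e \<subseteq> \<sigma> \<and> card e = 2}"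

lemma finite_edges_of: "finite \<sigma> \<Longrightarrow> finite (edges_of \<sigma>)"
  unfolding edges_of_def by (rule finite_subset[of _ "Pow \<sigma>"]) auto

lemma card_edges_of: "finite \<sigma> \<Longrightarrow> card (edges_of \<sigma>) = card \<sigma> choose 2"
  unfolding edges_of_def by (rule n_subsets)

lemma edges_of_Int: "edges_of (\<sigma> \<inter> \<tau>) = edges_of \<sigma> \<inter> edges_of \<tau>"
  by (auto simp: edges_of_def)

lemma edges_of_mono: "\<sigma> \<subseteq> \<tau> \<Longrightarrow> edges_of \<sigma> \<subseteq> edges_of \<tau>"
  by (auto simp: edges_of_def)

definition cliques :: "'a set \<Rightarrow> nat \<Rightarrow> 'a set set \<Rightarrow> 'a set set" where
  "cliques V s G = {\<sigma>. \<sigma> \<subseteq> V \<and> card \<sigma> = s \<and> edges_of \<sigma> \<subseteq> G}"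

definition supersets_of_size :: "'a set \<Rightarrow> nat \<Rightarrow> 'a set \<Rightarrow> 'a set set" where
  "supersets_of_size V s e = {\<sigma>. \<sigma> \<subseteq> V \<and> card \<sigma> = s \<and> e \<subseteq> \<sigma>}"

text \<open>
  The sets that become cliques, or remain cliques, when \<open>e\<close> is inserted; the condition ignores whether \<open>e\<close>
  itself belongs to \<open>G\<close>.
\<close>

definition cliques_through :: "'a set \<Rightarrow> nat \<Rightarrow> 'a set \<Rightarrow> 'a set set \<Rightarrow> 'a set set" where
  "cliques_through V s e G = {\<sigma> \<in> supersets_of_size V s e. edges_of \<sigma> - {e} \<subseteq> G}"

lemma finite_cliques: "finite V \<Longrightarrow> finite (cliques V s G)"
  unfolding cliques_def by (rule finite_subset[of _ "Pow V"]) auto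

lemma finite_supersets_of_size: "finite V \<Longrightarrow> finite (supersets_of_size V s e)"
  unfolding supersets_of_size_def by (rule finite_subset[of _ "Pow V"]) auto

lemma finite_cliques_through: "finite V \<Longrightarrow> finite (cliques_through V s e G)"
  unfolding cliques_through_def by (rule finite_subset[OF _ finite_supersets_of_size]) auto

lemma cliques_insert:
  assumes "card e = 2"
  shows "cliques V s (insert e G) = cliques V s (G - {e}) \<union> cliques_through V s e G"
    and "cliques V s (G - {e}) \<inter> cliques_through V s e G = {}"
proof -
  have mem: "e \<in> edges_of \<sigma> \<longleftrightarrow> e \<subseteq> \<sigma>" for \<sigma> using assms by (auto simp: edges_of_def)
  show "cliques V s (insert e G) = cliques V s (G - {e}) \<union> cliques_through V s e G"
    using mem unfolding cliques_def cliques_through_def supersets_of_size_def by blast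
  show "cliques V s (G - {e}) \<inter> cliques_through V s e G = {}"
    using mem unfolding cliques_def cliques_through_def supersets_of_size_def by blast
qed

lemma card_cliques_insert:
  assumes "finite V" "card e = 2"
  shows "card (cliques V s (insert e G)) = card (cliques V s (G - {e})) + card (cliques_through V s e G)"
proof -
  have "finite (cliques_through V s e G)" by (rule finite_cliques_through[OF assms(1)])
  then show ?thesis
    unfolding cliques_insert(1)[OF assms(2)]
    using finite_cliques[OF assms(1)] cliques_insert(2)[OF assms(2)] by (intro card_Un_disjoint) auto
qed

lemma card_supersets_of_size:
  assumes "finite V" "e \<subseteq> V" "card e = 2" "2 \<le> s"
  shows "card (supersets_of_size V s e) = (card V - 2) choose (s - 2)"
proof -
  have fin: "finite e" using assms finite_subset by blast
  have fin': "finite \<sigma>" if "\<sigma> \<subseteq> V" for \<sigma> using that assms finite_subset by blast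
  have "bij_betw (\<lambda>\<rho>. \<rho> \<union> e) {\<rho>. \<rho> \<subseteq> V - e \<and> card \<rho> = s - 2} (supersets_of_size V s e)"
  proof (rule bij_betw_byWitness[where f' = "\<lambda>\<sigma>. \<sigma> - e"])
    show "(\<lambda>\<rho>. \<rho> \<union> e) ` {\<rho>. \<rho> \<subseteq> V - e \<and> card \<rho> = s - 2} \<subseteq> supersets_of_size V s e"
    proof
      fix \<sigma> assume "\<sigma> \<in> (\<lambda>\<rho>. \<rho> \<union> e) ` {\<rho>. \<rho> \<subseteq> V - e \<and> card \<rho> = s - 2}"
      then obtain \<rho> where \<rho>: "\<rho> \<subseteq> V - e" "card \<rho> = s - 2" "\<sigma> = \<rho> \<union> e" by auto
      have "card \<sigma> = card \<rho> + card e"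
        unfolding \<rho>(3) by (rule card_Un_disjoint) (use \<rho>(1) fin fin'[of \<rho>] in auto)
      then show "\<sigma> \<in> supersets_of_size V s e" using \<rho> assms by (auto simp: supersets_of_size_def)
    qed
    show "(\<lambda>\<sigma>. \<sigma> - e) ` supersets_of_size V s e \<subseteq> {\<rho>. \<rho> \<subseteq> V - e \<and> card \<rho> = s - 2}"
      using fin assms(3) by (auto simp: supersets_of_size_def card_Diff_subset)
  qed (auto simp: supersets_of_size_def)
  then have "card (supersets_of_size V s e) = card {\<rho>. \<rho> \<subseteq> V - e \<and> card \<rho> = s - 2}"
    by (simp add: bij_betw_same_card)
  also have "\<dots> = card (V - e) choose (s - 2)" using assms(1) by (intro n_subsets) auto
  also have "card (V - e) = card V - 2" using assms fin by (simp add: card_Diff_subset)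
  finally show ?thesis .
qed

lemma real_card_filter: "finite S \<Longrightarrow> real (card {x \<in> S. P x}) = (\<Sum>x\<in>S. if P x then 1 else 0)"
  by (simp flip: sum.inter_filter)

lemma expected_cliques:
  assumes "finite V"
  shows "subset_mean (edges_of V) p (\<lambda>G. real (card (cliques V s G))) = real (card V choose s) * p ^ (s choose 2)"
proof -
  let ?S = "{\<sigma>. \<sigma> \<subseteq> V \<and> card \<sigma> = s}"
  have fin: "finite ?S" using assms by (auto intro: finite_subset[of _ "Pow V"])
  have "cliques V s G = {\<sigma> \<in> ?S. edges_of \<sigma> \<subseteq> G}" for G by (auto simp: cliques_def)
  then have "subset_mean (edges_of V) p (\<lambda>G. real (card (cliques V s G))) =
      (\<Sum>\<sigma>\<in>?S. subset_mean (edges_of V) p (\<lambda>G. if edges_of \<sigma> \<subseteq> G then 1 else 0))"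
    by (simp only: real_card_filter[OF fin] subset_mean_sum)
  also have "\<dots> = (\<Sum>\<sigma>\<in>?S. p ^ (s choose 2))"
  proof (rule sum.cong[OF refl])
    fix \<sigma> assume "\<sigma> \<in> ?S"
    then have \<sigma>: "\<sigma> \<subseteq> V" "card \<sigma> = s" "finite \<sigma>" using assms finite_subset by auto
    then show "subset_mean (edges_of V) p (\<lambda>G. if edges_of \<sigma> \<subseteq> G then 1 else 0) = p ^ (s choose 2)"
      using subset_mean_superset[OF finite_edges_of[OF assms] edges_of_mono[OF \<sigma>(1)], of p]
      by (simp add: card_edges_of)
  qed
  also have "\<dots> = real (card V choose s) * p ^ (s choose 2)"
    using n_subsets[OF assms] by simp
  finally show ?thesis .
qed

text \<open>
  The two cliques share the edges of \<open>\<sigma> \<inter> \<tau>\<close>. The edge \<open>e\<close> is removed from the union, which accounts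
  for the \<open>- 1\<close>.
\<close>

lemma card_edges_Un:
  assumes "finite V" "e \<subseteq> V" "card e = 2" "\<sigma> \<in> supersets_of_size V s e" "\<tau> \<in> supersets_of_size V s e"
  shows "card ((edges_of \<sigma> - {e}) \<union> (edges_of \<tau> - {e})) = 2 * (s choose 2) - 1 - (card (\<sigma> \<inter> \<tau>) choose 2)"
proof -
  have \<sigma>: "\<sigma> \<subseteq> V" "card \<sigma> = s" "e \<subseteq> \<sigma>" "finite \<sigma>" and \<tau>: "\<tau> \<subseteq> V" "card \<tau> = s" "e \<subseteq> \<tau>" "finite \<tau>"
    using assms finite_subset by (auto simp: supersets_of_size_def)
  have fin: "finite (edges_of \<sigma>)" "finite (edges_of \<tau>)" using \<sigma> \<tau> finite_edges_of by auto
  have "card (edges_of \<sigma> \<union> edges_of \<tau>) + card (edges_of (\<sigma> \<inter> \<tau>)) = card (edges_of \<sigma>) + card (edges_of \<tau>)"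
    unfolding edges_of_Int using card_Un_Int[OF fin] by simp
  then have "card (edges_of \<sigma> \<union> edges_of \<tau>) + (card (\<sigma> \<inter> \<tau>) choose 2) = 2 * (s choose 2)"
    using \<sigma> \<tau> by (simp add: card_edges_of)
  moreover have "e \<in> edges_of \<sigma> \<union> edges_of \<tau>" using \<sigma> assms(3) by (simp add: edges_of_def)
  then have "card (edges_of \<sigma> \<union> edges_of \<tau> - {e}) = card (edges_of \<sigma> \<union> edges_of \<tau>) - 1"
    using fin by simp
  moreover have "(edges_of \<sigma> - {e}) \<union> (edges_of \<tau> - {e}) = edges_of \<sigma> \<union> edges_of \<tau> - {e}" by auto
  ultimately show ?thesis by simp
qed

lemma expected_cliques_through:
  assumes "finite V" "e \<subseteq> V" "card e = 2" "2 \<le> s"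
  shows "subset_mean (edges_of V) p (\<lambda>G. real (card (cliques_through V s e G))) =
    real ((card V - 2) choose (s - 2)) * p ^ ((s choose 2) - 1)"
proof -
  let ?S = "supersets_of_size V s e"
  note fin = finite_supersets_of_size[OF assms(1), of s e]
  have "subset_mean (edges_of V) p (\<lambda>G. real (card (cliques_through V s e G))) =
      (\<Sum>\<sigma>\<in>?S. subset_mean (edges_of V) p (\<lambda>G. if edges_of \<sigma> - {e} \<subseteq> G then 1 else 0))"
    by (simp only: cliques_through_def real_card_filter[OF fin] subset_mean_sum)
  also have "\<dots> = (\<Sum>\<sigma>\<in>?S. p ^ ((s choose 2) - 1))"
  proof (rule sum.cong[OF refl])
    fix \<sigma> assume \<sigma>: "\<sigma> \<in> ?S"
    then have "finite \<sigma>" "\<sigma> \<subseteq> V" "card \<sigma> = s" using assms finite_subset by (auto simp: supersets_of_size_def)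
    moreover have "card (edges_of \<sigma> - {e}) = (s choose 2) - 1"
      using card_edges_Un[OF assms(1-3) \<sigma> \<sigma>] \<open>card \<sigma> = s\<close> by simp
    ultimately show "subset_mean (edges_of V) p (\<lambda>G. if edges_of \<sigma> - {e} \<subseteq> G then 1 else 0) = p ^ ((s choose 2) - 1)"
      using subset_mean_superset[OF finite_edges_of[OF assms(1)], of "edges_of \<sigma> - {e}" p] edges_of_mono[of \<sigma> V] by auto
  qed
  also have "\<dots> = real ((card V - 2) choose (s - 2)) * p ^ ((s choose 2) - 1)"
    using card_supersets_of_size[OF assms] by simp
  finally show ?thesis .
qed

lemma binomial_le_power: "n choose r \<le> n ^ r"
  by (cases "r \<le> n") (simp_all add: binomial_le_pow binomial_eq_0)

lemma card_supersets_meeting_le: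
  assumes "finite V" "\<sigma> \<in> supersets_of_size V s e" "i \<le> s"
  shows "card {\<tau> \<in> supersets_of_size V s e. card (\<sigma> \<inter> \<tau>) = i} \<le> 2 ^ s * card V ^ (s - i)"
proof -
  have \<sigma>: "finite \<sigma>" "card \<sigma> = s" using assms finite_subset by (auto simp: supersets_of_size_def)
  let ?B = "{\<rho>. \<rho> \<subseteq> V \<and> card \<rho> = s - i}"
  have finB: "finite ?B" using assms(1) by (auto intro: finite_subset[of _ "Pow V"])
  have "card {\<tau> \<in> supersets_of_size V s e. card (\<sigma> \<inter> \<tau>) = i} \<le> card (Pow \<sigma> \<times> ?B)"
  proof (rule card_inj_on_le[where f = "\<lambda>\<tau>. (\<sigma> \<inter> \<tau>, \<tau> - \<sigma>)"])
    show "inj_on (\<lambda>\<tau>. (\<sigma> \<inter> \<tau>, \<tau> - \<sigma>)) {\<tau> \<in> supersets_of_size V s e. card (\<sigma> \<inter> \<tau>) = i}"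
      by (intro inj_onI) auto
    show "(\<lambda>\<tau>. (\<sigma> \<inter> \<tau>, \<tau> - \<sigma>)) ` {\<tau> \<in> supersets_of_size V s e. card (\<sigma> \<inter> \<tau>) = i} \<subseteq> Pow \<sigma> \<times> ?B"
    proof
      fix z assume "z \<in> (\<lambda>\<tau>. (\<sigma> \<inter> \<tau>, \<tau> - \<sigma>)) ` {\<tau> \<in> supersets_of_size V s e. card (\<sigma> \<inter> \<tau>) = i}"
      then obtain \<tau> where \<tau>: "z = (\<sigma> \<inter> \<tau>, \<tau> - \<sigma>)" "\<tau> \<subseteq> V" "card \<tau> = s" "card (\<sigma> \<inter> \<tau>) = i"
        by (auto simp: supersets_of_size_def)
      have "finite \<tau>" using \<tau>(2) assms(1) finite_subset by blast
      then have "card (\<tau> - \<sigma>) = s - i"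
        using \<tau>(3,4) by (simp add: card_Diff_subset_Int Int_commute)
      then show "z \<in> Pow \<sigma> \<times> ?B" using \<tau> by auto
    qed
    show "finite (Pow \<sigma> \<times> ?B)" using \<sigma> finB by simp
  qed
  also have "\<dots> = 2 ^ s * (card V choose (s - i))"
    using \<sigma> n_subsets[OF assms(1)] by (simp add: card_cartesian_product card_Pow)
  also have "\<dots> \<le> 2 ^ s * card V ^ (s - i)" by (intro mult_left_mono binomial_le_power) auto
  finally show ?thesis .
qed

text \<open>
  Pairs of cliques are sorted by the number \<open>i\<close> of common vertices. The pairs with \<open>i = 2\<close> share nothing
  but \<open>e\<close> and contribute at most the square of the mean; the others are counted by choosing the
  intersection and the remaining \<open>s - i\<close> vertices of the second clique.
\<close>

lemma second_moment_cliques_through: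
  assumes "finite V" "e \<subseteq> V" "card e = 2" "2 \<le> s" "0 \<le> p"
  defines "m \<equiv> s choose 2" and "n \<equiv> card V"
  shows "subset_mean (edges_of V) p (\<lambda>G. (real (card (cliques_through V s e G)))\<^sup>2) \<le>
    (real ((n - 2) choose (s - 2)) * p ^ (m - 1))\<^sup>2 +
    (\<Sum>i=3..s. 2 ^ s * real n ^ (s - 2 + (s - i)) * p ^ (2 * m - 1 - (i choose 2)))"
proof -
  let ?S = "supersets_of_size V s e"
  let ?q = "\<lambda>i. p ^ (2 * m - 1 - (i choose 2))"
  note fin = finite_supersets_of_size[OF assms(1), of s e]
  have cardS: "card ?S = (n - 2) choose (s - 2)" using card_supersets_of_size[OF assms(1-4)] by (simp add: n_def)
  have "(n - 2) choose (s - 2) \<le> n ^ (s - 2)"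
    by (rule order_trans[OF binomial_le_power]) (simp add: power_mono)
  then have cardS_le: "real (card ?S) \<le> real n ^ (s - 2)" unfolding cardS by (metis of_nat_le_iff of_nat_power)
  have "(real (card (cliques_through V s e G)))\<^sup>2 = (\<Sum>\<sigma>\<in>?S. \<Sum>\<tau>\<in>?S.
      if (edges_of \<sigma> - {e}) \<union> (edges_of \<tau> - {e}) \<subseteq> G then 1 else 0)" for G
    unfolding cliques_through_def real_card_filter[OF fin] power2_eq_square sum_product
    by (intro sum.cong refl) auto
  then have "subset_mean (edges_of V) p (\<lambda>G. (real (card (cliques_through V s e G)))\<^sup>2) =
      (\<Sum>\<sigma>\<in>?S. \<Sum>\<tau>\<in>?S. subset_mean (edges_of V) p (\<lambda>G. if (edges_of \<sigma> - {e}) \<union> (edges_of \<tau> - {e}) \<subseteq> G then 1 else 0))"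
    by (simp only: subset_mean_sum)
  also have "\<dots> = (\<Sum>\<sigma>\<in>?S. \<Sum>\<tau>\<in>?S. ?q (card (\<sigma> \<inter> \<tau>)))"
  proof (intro sum.cong refl)
    fix \<sigma> \<tau> assume \<sigma>\<tau>: "\<sigma> \<in> ?S" "\<tau> \<in> ?S"
    then have sub: "(edges_of \<sigma> - {e}) \<union> (edges_of \<tau> - {e}) \<subseteq> edges_of V"
      by (auto simp: supersets_of_size_def edges_of_def)
    show "subset_mean (edges_of V) p (\<lambda>G. if (edges_of \<sigma> - {e}) \<union> (edges_of \<tau> - {e}) \<subseteq> G then 1 else 0) = ?q (card (\<sigma> \<inter> \<tau>))"
      unfolding subset_mean_superset[OF finite_edges_of[OF assms(1)] sub] card_edges_Un[OF assms(1-3) \<sigma>\<tau>] m_def ..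
  qed
  also have "\<dots> \<le> (\<Sum>\<sigma>\<in>?S. \<Sum>\<tau>\<in>?S. p ^ (2 * m - 2) + (\<Sum>i=3..s. if card (\<sigma> \<inter> \<tau>) = i then ?q i else 0))"
  proof (intro sum_mono)
    fix \<sigma> \<tau> assume "\<sigma> \<in> ?S" "\<tau> \<in> ?S"
    then have "finite \<sigma>" "e \<subseteq> \<sigma> \<inter> \<tau>" "card \<sigma> = s"
      using assms(1) finite_subset by (auto simp: supersets_of_size_def)
    then have "2 \<le> card (\<sigma> \<inter> \<tau>)" "card (\<sigma> \<inter> \<tau>) \<le> s"
      using assms(3) card_mono[of "\<sigma> \<inter> \<tau>" e] card_mono[of \<sigma> "\<sigma> \<inter> \<tau>"] by auto
    moreover have q2: "2 * m - 1 - (2 choose 2) = 2 * m - 2" by simp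
    ultimately show "?q (card (\<sigma> \<inter> \<tau>)) \<le> p ^ (2 * m - 2) + (\<Sum>i=3..s. if card (\<sigma> \<inter> \<tau>) = i then ?q i else 0)"
    proof (cases "card (\<sigma> \<inter> \<tau>) = 2")
      case True
      show ?thesis unfolding True q2 using assms(5) by (simp add: sum_nonneg)
    qed (use assms(5) in simp)
  qed
  also have "\<dots> = (\<Sum>\<sigma>\<in>?S. \<Sum>\<tau>\<in>?S. p ^ (2 * m - 2)) +
      (\<Sum>i=3..s. \<Sum>\<sigma>\<in>?S. \<Sum>\<tau>\<in>?S. if card (\<sigma> \<inter> \<tau>) = i then ?q i else 0)"
    by (simp only: sum.distrib sum.swap[where B = "{3..s}"])
  also have "(\<Sum>\<sigma>\<in>?S. \<Sum>\<tau>\<in>?S. p ^ (2 * m - 2)) = (real ((n - 2) choose (s - 2)) * p ^ (m - 1))\<^sup>2"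
    unfolding cardS[symmetric] by (simp add: power_mult_distrib power2_eq_square diff_mult_distrib2 flip: power_add mult_2)
  also have "(\<Sum>i=3..s. \<Sum>\<sigma>\<in>?S. \<Sum>\<tau>\<in>?S. if card (\<sigma> \<inter> \<tau>) = i then ?q i else 0) \<le>
      (\<Sum>i=3..s. 2 ^ s * real n ^ (s - 2 + (s - i)) * ?q i)"
  proof (rule sum_mono)
    fix i assume i: "i \<in> {3..s}"
    have "(\<Sum>\<sigma>\<in>?S. \<Sum>\<tau>\<in>?S. if card (\<sigma> \<inter> \<tau>) = i then ?q i else 0) =
        (\<Sum>\<sigma>\<in>?S. real (card {\<tau> \<in> ?S. card (\<sigma> \<inter> \<tau>) = i}) * ?q i)"
      using fin by (simp flip: sum.inter_filter)
    also have "\<dots> \<le> (\<Sum>\<sigma>\<in>?S. (2 ^ s * real n ^ (s - i)) * ?q i)"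
    proof (intro sum_mono mult_right_mono)
      fix \<sigma> assume "\<sigma> \<in> ?S"
      then show "real (card {\<tau> \<in> ?S. card (\<sigma> \<inter> \<tau>) = i}) \<le> 2 ^ s * real n ^ (s - i)"
        using card_supersets_meeting_le[OF assms(1), of \<sigma> s e i] i unfolding n_def
        by (metis (no_types, lifting) atLeastAtMost_iff of_nat_le_iff of_nat_mult of_nat_numeral of_nat_power)
    qed (use assms(5) in auto)
    also have "\<dots> = real (card ?S) * ((2 ^ s * real n ^ (s - i)) * ?q i)" by simp
    also have "\<dots> \<le> real n ^ (s - 2) * ((2 ^ s * real n ^ (s - i)) * ?q i)"
      using cardS_le assms(5) by (intro mult_right_mono) auto
    also have "\<dots> = 2 ^ s * real n ^ (s - 2 + (s - i)) * ?q i" by (simp add: power_add)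
    finally show "(\<Sum>\<sigma>\<in>?S. \<Sum>\<tau>\<in>?S. if card (\<sigma> \<inter> \<tau>) = i then ?q i else 0) \<le>
        2 ^ s * real n ^ (s - 2 + (s - i)) * ?q i" .
  qed
  finally show ?thesis by simp
qed

section \<open>Linearization of the Betti number\<close>

text \<open>
  The numbers of edges of cliques, compared with the exponent of \<open>p\<close> in \<open>(n p\<^sup>k)\<^sup>i\<^sup>-\<^sup>2\<close>.
\<close>

lemma choose_two_le:
  assumes "2 \<le> i" "i \<le> k + 1"
  shows "i choose 2 \<le> k * (i - 2) + 1"
proof -
  obtain j where j: "i = j + 2" using assms(1) by (metis le_add_diff_inverse2)
  have "j * (j + 3) \<le> j * (2 * k)"
  proof (cases "j = 0")
    case False
    then have "j + 3 \<le> 2 * k" using assms j by simp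
    then show ?thesis by (rule mult_left_mono) simp
  qed simp
  then have "(j + 2) * (j + 1) \<le> 2 * (k * j + 1)" by (simp add: algebra_simps)
  then show ?thesis unfolding j choose_two by simp
qed

lemma choose_two_mono: "i \<le> j \<Longrightarrow> i choose 2 \<le> j choose 2"
  unfolding choose_two by (intro div_le_mono mult_le_mono diff_le_mono)

text \<open>
  Up to constants, \<open>n p\<^sup>k\<close> is the expected number of vertices that extend a given \<open>k\<close>-clique and
  \<open>n p\<^sup>k\<^sup>+\<^sup>1\<close> is that for a given \<open>(k+1)\<close>-clique. Below these are called \<open>x\<close> and \<open>y\<close>. The number \<open>m\<close> counts the edges of a
  \<open>(k+1)\<close>-clique, and \<open>A\<close> is the order of magnitude of the expected number of \<open>(k+1)\<close>-cliques that contain a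
  given pair of vertices whose edge is present.
\<close>

locale clique_range =
  fixes k n :: nat and p :: real
  assumes k: "1 \<le> k" and p: "0 < p" "p \<le> 1"
    and x_ge: "1 \<le> real n * p ^ k" and y_le: "real n * p ^ (k + 1) \<le> 1"
begin

definition m where "m = (k + 1) choose 2"
definition x where "x = real n * p ^ k"
definition y where "y = real n * p ^ (k + 1)"
definition A where "A = real n ^ (k - 1) * p ^ (m - 1)"

lemma m_Suc: "(k + 2) choose 2 = m + k + 1"
  by (simp add: m_def numeral_2_eq_2)

lemma m_pred: "m = (k choose 2) + k"
  by (simp add: m_def numeral_2_eq_2)

lemma m_pos: "1 \<le> m"
  using m_pred k by simp

lemma x_ge_1: "1 \<le> x" and y_le_1: "y \<le> 1" and y_nonneg: "0 \<le> y" and A_nonneg: "0 \<le> A"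
  using x_ge y_le p by (simp_all add: x_def y_def A_def)

lemma x_power_le:
  assumes "2 \<le> i" "i \<le> k + 1"
  shows "x ^ (i - 2) \<le> real n ^ (i - 2) * p ^ ((i choose 2) - 1)"
proof -
  have "p ^ (k * (i - 2)) \<le> p ^ ((i choose 2) - 1)"
    using choose_two_le[OF assms] p by (intro power_decreasing) auto
  then have "real n ^ (i - 2) * p ^ (k * (i - 2)) \<le> real n ^ (i - 2) * p ^ ((i choose 2) - 1)"
    by (rule mult_left_mono) simp
  then show ?thesis by (simp add: x_def power_mult_distrib power_mult)
qed

lemma A_ge_1: "1 \<le> A"
proof -
  have "1 \<le> x ^ (k - 1)" using x_ge_1 by (rule one_le_power)
  also have "\<dots> \<le> A" using x_power_le[of "k + 1"] k by (simp add: A_def m_def)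
  finally show ?thesis .
qed

text \<open>
  The contribution of the pairs of \<open>(k+1)\<close>-cliques that share \<open>i > 2\<close> vertices is smaller than the square
  of the mean by the factor \<open>n\<^sup>i\<^sup>-\<^sup>2 p\<^sup>C\<^sup>-\<^sup>1\<close> with \<open>C = i choose 2\<close>, which is at least \<open>x\<^sup>i\<^sup>-\<^sup>2\<close>.
\<close>

lemma overlap_term_le:
  assumes "3 \<le> i" "i \<le> k + 1"
  shows "real n ^ (2 * k - i) * p ^ (2 * m - 1 - (i choose 2)) \<le> A\<^sup>2 / x"
proof -
  let ?a = "real n ^ (2 * k - i) * p ^ (2 * m - 1 - (i choose 2))"
  have i: "1 \<le> i choose 2" "i choose 2 \<le> m"
  proof -
    have "3 choose 2 \<le> i choose 2" using assms(1) by (rule choose_two_mono)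
    then show "1 \<le> i choose 2" by (simp add: eval_nat_numeral)
    show "i choose 2 \<le> m" unfolding m_def using assms(2) by (rule choose_two_mono)
  qed
  have "?a * x \<le> ?a * x ^ (i - 2)"
    using assms(1) x_ge_1 p by (intro mult_left_mono self_le_power) auto
  also have "\<dots> \<le> ?a * (real n ^ (i - 2) * p ^ ((i choose 2) - 1))"
    using x_power_le[of i] assms p by (intro mult_left_mono) auto
  also have "\<dots> = real n ^ (2 * k - i + (i - 2)) * p ^ (2 * m - 1 - (i choose 2) + ((i choose 2) - 1))"
    by (simp add: power_add)
  also have "2 * k - i + (i - 2) = 2 * (k - 1)" using assms k by simp
  also have "2 * m - 1 - (i choose 2) + ((i choose 2) - 1) = 2 * (m - 1)" using i m_pos by simp
  also have "real n ^ (2 * (k - 1)) * p ^ (2 * (m - 1)) = A\<^sup>2"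
    by (simp add: A_def power_mult_distrib power_even_eq)
  finally show ?thesis using x_ge_1 by (simp add: field_simps)
qed

lemma variance_cliques_through:
  fixes V :: "'a set" and e :: "'a set"
  assumes V: "finite V" "card V = n" and e: "e \<subseteq> V" "card e = 2"
  defines "\<mu> \<equiv> real ((n - 2) choose (k - 1)) * p ^ (m - 1)"
  shows "subset_mean (edges_of V) p (\<lambda>G. (real (card (cliques_through V (k + 1) e G)) - \<mu>)\<^sup>2) \<le> real k * 2 ^ (k + 1) * (A\<^sup>2 / x)"
proof -
  let ?N = "\<lambda>G. real (card (cliques_through V (k + 1) e G))"
  have fin: "finite (edges_of V)" using V finite_edges_of by blast
  have mean: "subset_mean (edges_of V) p ?N = \<mu>"
    using expected_cliques_through[OF V(1) e, of "k + 1" p] k V by (simp add: \<mu>_def m_def)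
  have "subset_mean (edges_of V) p (\<lambda>G. (?N G - \<mu>)\<^sup>2) = subset_variance (edges_of V) p ?N"
    unfolding subset_variance_def mean ..
  also have "\<dots> = subset_mean (edges_of V) p (\<lambda>G. (?N G)\<^sup>2) - \<mu>\<^sup>2"
    using subset_variance_eq[OF fin] mean by simp
  also have "\<dots> \<le> (\<Sum>i=3..k+1. 2 ^ (k + 1) * real n ^ (k + 1 - 2 + (k + 1 - i)) * p ^ (2 * m - 1 - (i choose 2)))"
    using second_moment_cliques_through[OF V(1) e, of "k + 1" p] k V p by (simp add: \<mu>_def m_def)
  also have "\<dots> \<le> (\<Sum>i=3..k+1. 2 ^ (k + 1) * (A\<^sup>2 / x))"
  proof (rule sum_mono)
    fix i assume i: "i \<in> {3..k+1}"
    then have eq: "k + 1 - 2 + (k + 1 - i) = 2 * k - i" by simp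
    show "2 ^ (k + 1) * real n ^ (k + 1 - 2 + (k + 1 - i)) * p ^ (2 * m - 1 - (i choose 2)) \<le> 2 ^ (k + 1) * (A\<^sup>2 / x)"
      unfolding eq mult.assoc using overlap_term_le[of i] i by (intro mult_left_mono) auto
  qed
  also have "\<dots> = real (k - 1) * (2 ^ (k + 1) * (A\<^sup>2 / x))" by simp
  also have "\<dots> \<le> real k * (2 ^ (k + 1) * (A\<^sup>2 / x))"
    using x_ge_1 by (intro mult_right_mono) auto
  finally show ?thesis by (simp only: mult.assoc)
qed

text \<open>
  Compared with cliques of size \<open>k + 1\<close>, the additional vertex of each of two different cliques contributes
  a factor \<open>y\<close> to the bounds obtained above. The diagonal terms add up to the mean, which is of order \<open>A y\<close>;
  this is at most \<open>A\<^sup>2 y\<close> since \<open>A \<ge> 1\<close>.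
\<close>

lemma second_moment_larger_cliques:
  fixes V :: "'a set" and e :: "'a set"
  assumes V: "finite V" "card V = n" and e: "e \<subseteq> V" "card e = 2"
  shows "subset_mean (edges_of V) p (\<lambda>G. (real (card (cliques_through V (k + 2) e G)))\<^sup>2) \<le> (1 + real k * 2 ^ (k + 2)) * (A\<^sup>2 * y)"
proof -
  let ?m' = "(k + 2) choose 2"
  have Ay: "real n ^ k * p ^ (?m' - 1) = A * y"
  proof -
    have "real n ^ k = real n ^ (k - 1) * real n" using k by (simp flip: power_Suc2)
    moreover have "?m' - 1 = (m - 1) + (k + 1)" using m_Suc m_pos by simp
    ultimately show ?thesis by (simp add: A_def y_def power_add)
  qed
  have A2y: "0 \<le> A\<^sup>2 * y" using y_nonneg by simp
  have "subset_mean (edges_of V) p (\<lambda>G. (real (card (cliques_through V (k + 2) e G)))\<^sup>2) \<le>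
      (real ((n - 2) choose k) * p ^ (?m' - 1))\<^sup>2 +
      (\<Sum>i=3..k+2. 2 ^ (k + 2) * real n ^ (k + (k + 2 - i)) * p ^ (2 * ?m' - 1 - (i choose 2)))"
    using second_moment_cliques_through[OF V(1) e, of "k + 2" p] V p by simp
  also have "\<dots> \<le> A\<^sup>2 * y + (\<Sum>i=3..k+2. 2 ^ (k + 2) * (A\<^sup>2 * y))"
  proof (rule add_mono)
    have "(n - 2) choose k \<le> n ^ k"
      by (rule order_trans[OF binomial_le_power]) (simp add: power_mono)
    then have "real ((n - 2) choose k) \<le> real n ^ k" by (metis of_nat_le_iff of_nat_power)
    then have "real ((n - 2) choose k) * p ^ (?m' - 1) \<le> A * y"
      unfolding Ay[symmetric] using p by (intro mult_right_mono) auto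
    then have "(real ((n - 2) choose k) * p ^ (?m' - 1))\<^sup>2 \<le> (A * y)\<^sup>2"
      using p by (intro power_mono) auto
    also have "\<dots> = A\<^sup>2 * y * y" by (simp add: power2_eq_square)
    also have "\<dots> \<le> A\<^sup>2 * y" using A2y y_le_1 by (intro mult_left_le) auto
    finally show "(real ((n - 2) choose k) * p ^ (?m' - 1))\<^sup>2 \<le> A\<^sup>2 * y" .
    show "(\<Sum>i=3..k+2. 2 ^ (k + 2) * real n ^ (k + (k + 2 - i)) * p ^ (2 * ?m' - 1 - (i choose 2))) \<le>
        (\<Sum>i=3..k+2. 2 ^ (k + 2) * (A\<^sup>2 * y))"
    proof (rule sum_mono)
      fix i assume i: "i \<in> {3..k+2}"
      have "real n ^ (k + (k + 2 - i)) * p ^ (2 * ?m' - 1 - (i choose 2)) \<le> A\<^sup>2 * y"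
      proof (cases "i = k + 2")
        \<comment> \<open>the diagonal \<open>\<sigma> = \<tau>\<close>\<close>
        case True
        then have "real n ^ (k + (k + 2 - i)) * p ^ (2 * ?m' - 1 - (i choose 2)) = A * y"
          using Ay by simp
        also have "\<dots> \<le> A * y * A" using mult_left_mono[OF A_ge_1, of "A * y"] A_nonneg y_nonneg by simp
        finally show ?thesis by (simp add: power2_eq_square mult_ac)
      next
        case False
        then have i': "3 \<le> i" "i \<le> k + 1" using i by auto
        have "i choose 2 \<le> m" unfolding m_def using i'(2) by (rule choose_two_mono)
        then have "2 * ?m' - 1 - (i choose 2) = (2 * m - 1 - (i choose 2)) + 2 * (k + 1)"
          using m_Suc m_pos by simp
        moreover have "k + (k + 2 - i) = (2 * k - i) + 2" using i' k by simp
        moreover have y_square: "y\<^sup>2 = (real n)\<^sup>2 * p ^ (2 * (k + 1))"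
          unfolding y_def power_mult_distrib by (simp only: power_mult[symmetric] mult.commute)
        ultimately have "real n ^ (k + (k + 2 - i)) * p ^ (2 * ?m' - 1 - (i choose 2)) =
            (real n ^ (2 * k - i) * p ^ (2 * m - 1 - (i choose 2))) * y\<^sup>2"
          by (simp only: power_add y_square mult_ac)
        also have "\<dots> \<le> (A\<^sup>2 / x) * y\<^sup>2"
          using overlap_term_le[OF i'] by (rule mult_right_mono) simp
        also have "\<dots> \<le> A\<^sup>2 * y"
        proof -
          have "A\<^sup>2 / x \<le> A\<^sup>2" using x_ge_1 by (simp add: divide_le_eq mult_le_cancel_left1)
          moreover have "y\<^sup>2 \<le> y" using y_nonneg y_le_1 by (simp add: power2_eq_square mult_left_le)
          ultimately show ?thesis by (intro mult_mono) auto
        qed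
        finally show ?thesis .
      qed
      then show "2 ^ (k + 2) * real n ^ (k + (k + 2 - i)) * p ^ (2 * ?m' - 1 - (i choose 2)) \<le> 2 ^ (k + 2) * (A\<^sup>2 * y)"
        unfolding mult.assoc by (intro mult_left_mono) auto
    qed
  qed
  also have "\<dots> = (1 + real k * 2 ^ (k + 2)) * (A\<^sup>2 * y)" by (simp add: algebra_simps)
  finally show ?thesis .
qed

end

text \<open>
  If \<open>N\<close> is concentrated at \<open>\<mu>\<close>, then the second moment of a quantity between \<open>0\<close> and \<open>N\<close> is controlled by
  its mean.
\<close>

lemma square_le_of_le:
  fixes b N \<mu> :: real
  assumes "0 \<le> b" "b \<le> N"
  shows "b\<^sup>2 \<le> 2 * \<mu> * b + (N - \<mu>)\<^sup>2"
proof -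
  have "b\<^sup>2 \<le> b * N" using assms by (simp add: power2_eq_square mult_left_mono)
  moreover have "0 \<le> (b - (N - \<mu>))\<^sup>2" by simp
  ultimately show ?thesis by (simp add: power2_eq_square algebra_simps)
qed

lemma square_of_three_le: "(a - b - c)\<^sup>2 \<le> 3 * (a\<^sup>2 + b\<^sup>2 + c\<^sup>2)" for a b c :: real
proof -
  have "3 * (a\<^sup>2 + b\<^sup>2 + c\<^sup>2) - (a - b - c)\<^sup>2 = (a + b)\<^sup>2 + (a + c)\<^sup>2 + (b - c)\<^sup>2"
    by (simp add: power2_eq_square algebra_simps)
  then show ?thesis by (smt (verit) zero_le_power2)
qed

text \<open>
  The rank functions \<open>r1\<close> and \<open>r2\<close> stand for the ranks of the boundary maps \<open>\<partial>\<^sub>k\<close> and \<open>\<partial>\<^sub>k\<^sub>+\<^sub>1\<close>; the former is at most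
  the number of \<open>(k-1)\<close>-faces, which are the \<open>k\<close>-cliques. The constant \<open>c\<close> makes \<open>A\<close> comparable to \<open>\<mu>\<close>.
\<close>

locale clique_ranks = clique_range k n p + r1: matroid_rank r1 + r2: matroid_rank r2
  for k n :: nat and p :: real and r1 r2 :: "'a set set \<Rightarrow> nat" +
  fixes V :: "'a set" and c :: real
  assumes V: "finite V" "card V = n"
    and r1_le: "\<And>G. r1 (cliques V (k + 1) G) \<le> card (cliques V k G)"
    and n: "2 \<le> n"
    and c: "0 < c" "c * real n ^ (k - 1) \<le> real ((n - 2) choose (k - 1))"
begin

definition \<mu> where "\<mu> = real ((n - 2) choose (k - 1)) * p ^ (m - 1)"

text \<open>
  For the ranks of the boundary maps this is the \<open>k\<close>-th Betti number of the clique complex.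
\<close>

definition excess :: "'a set set \<Rightarrow> real" where
  "excess G = real (card (cliques V (k + 1) G)) - real (r1 (cliques V (k + 1) G)) - real (r2 (cliques V (k + 2) G))"

abbreviation "E \<equiv> edges_of V"

lemma finE: "finite E" using V finite_edges_of by blast

lemma cA_le: "c * A \<le> \<mu>"
  using mult_right_mono[OF c(2), of "p ^ (m - 1)"] p by (simp add: A_def \<mu>_def)

lemma \<mu>_pos: "0 < \<mu>"
  using cA_le A_ge_1 c(1) by (intro less_le_trans[OF _ cA_le] mult_pos_pos) auto

text \<open>
  The increment at \<open>e\<close> is independent of the presence of \<open>e\<close>. Hence \<open>p\<close> times its mean is the mean of the
  rank drop over the graphs that contain \<open>e\<close>, and the deterministic bound for the sum of these applies.
\<close>

lemma expected_rank_drops_le: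
  "(\<Sum>e\<in>E. subset_mean E p (\<lambda>G. real (r1 (cliques V (k + 1) (insert e G))) - real (r1 (cliques V (k + 1) (G - {e}))))) \<le>
    2 ^ m * (real n ^ k * p ^ (k choose 2)) / p"
proof -
  let ?r = "\<lambda>G. r1 (cliques V (k + 1) G)"
  let ?d = "\<lambda>e G. real (?r (insert e G)) - real (?r (G - {e}))"
  have "p * (\<Sum>e\<in>E. subset_mean E p (?d e)) = (\<Sum>e\<in>E. subset_mean E p (\<lambda>G. if e \<in> G then ?d e G else 0))"
    unfolding sum_distrib_left using finE by (intro sum.cong refl subset_mean_if_mem[symmetric]) (auto simp: insert_absorb)
  also have "\<dots> = subset_mean E p (\<lambda>G. \<Sum>e\<in>E. if e \<in> G then ?d e G else 0)"
    by (rule subset_mean_sum[symmetric])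
  also have "\<dots> \<le> subset_mean E p (\<lambda>G. 2 ^ m * real (card (cliques V k G)))"
  proof (rule subset_mean_mono)
    fix G assume G: "G \<subseteq> E"
    then have finG: "finite G" using finE finite_subset by blast
    let ?K = "cliques V (k + 1) G"
    have K: "finite ?K" using V finite_cliques by blast
    have drop: "{\<sigma> \<in> ?K. e \<notin> edges_of \<sigma>} = cliques V (k + 1) (G - {e})" for e
      by (auto simp: cliques_def)
    have "(\<Sum>e\<in>E. if e \<in> G then ?d e G else 0) = (\<Sum>e\<in>G. ?d e G)"
      using G finE by (simp add: sum.If_cases Int_absorb1)
    also have "\<dots> = (\<Sum>e\<in>G. real (r1 ?K - r1 {\<sigma> \<in> ?K. e \<notin> edges_of \<sigma>}))"
    proof (intro sum.cong refl)
      fix e assume "e \<in> G"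
      moreover have "r1 {\<sigma> \<in> ?K. e \<notin> edges_of \<sigma>} \<le> r1 ?K" using K by (intro r1.rk_mono) auto
      ultimately show "?d e G = real (r1 ?K - r1 {\<sigma> \<in> ?K. e \<notin> edges_of \<sigma>})"
        unfolding drop by (simp add: insert_absorb)
    qed
    also have "\<dots> = real (\<Sum>e\<in>G. r1 ?K - r1 {\<sigma> \<in> ?K. e \<notin> edges_of \<sigma>})" by simp
    also have "\<dots> \<le> real (2 ^ m * r1 ?K)"
    proof -
      have "edges_of \<sigma> \<subseteq> G \<and> card (edges_of \<sigma>) = m" if "\<sigma> \<in> ?K" for \<sigma>
      proof -
        have \<sigma>: "\<sigma> \<subseteq> V" "card \<sigma> = k + 1" "edges_of \<sigma> \<subseteq> G" using that by (auto simp: cliques_def)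
        then have "finite \<sigma>" using V(1) finite_subset by blast
        then show ?thesis using \<sigma> by (simp add: card_edges_of m_def)
      qed
      from r1.sum_rank_drops_le[OF K finG this] show ?thesis by (simp only: of_nat_le_iff)
    qed
    also have "\<dots> \<le> 2 ^ m * real (card (cliques V k G))" using r1_le[of G] by simp
    finally show "(\<Sum>e\<in>E. if e \<in> G then ?d e G else 0) \<le> 2 ^ m * real (card (cliques V k G))" .
  qed (use p in auto)
  also have "\<dots> = 2 ^ m * (real (n choose k) * p ^ (k choose 2))"
    unfolding subset_mean_cmult expected_cliques[OF V(1)] V(2) ..
  also have "\<dots> \<le> 2 ^ m * (real n ^ k * p ^ (k choose 2))"
    using binomial_le_power[of n k] p by (intro mult_left_mono mult_right_mono) (auto simp flip: of_nat_power)
  finally show ?thesis using p by (simp add: field_simps)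
qed

lemma excess_increment_bound:
  assumes e: "e \<in> E"
  defines "N \<equiv> \<lambda>G. real (card (cliques_through V (k + 1) e G))"
    and "N' \<equiv> \<lambda>G. real (card (cliques_through V (k + 2) e G))"
    and "d \<equiv> \<lambda>G. real (r1 (cliques V (k + 1) (insert e G))) - real (r1 (cliques V (k + 1) (G - {e})))"
  shows "(excess (insert e G) - excess (G - {e}) - \<mu>)\<^sup>2 \<le> 6 * (N G - \<mu>)\<^sup>2 + 6 * \<mu> * d G + 3 * (N' G)\<^sup>2"
proof -
  have e2: "card e = 2" using e by (simp add: edges_of_def)
  define d' where "d' = real (r2 (cliques V (k + 2) (insert e G))) - real (r2 (cliques V (k + 2) (G - {e})))"
  have fin: "finite (cliques V s H)" "finite (cliques_through V s e H)" for s H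
    using finite_cliques[OF V(1)] finite_cliques_through[OF V(1)] by blast+
  have d: "0 \<le> d G" "d G \<le> N G" and d': "0 \<le> d'" "d' \<le> N' G"
  proof -
    let ?K = "\<lambda>s. cliques V s (G - {e})" and ?T = "\<lambda>s. cliques_through V s e G"
    have "r1 (?K (k + 1)) \<le> r1 (?K (k + 1) \<union> ?T (k + 1))"
      "r1 (?K (k + 1) \<union> ?T (k + 1)) \<le> r1 (?K (k + 1)) + card (?T (k + 1))"
      using fin by (intro r1.rk_mono r1.rk_Un_le; simp)+
    then show "0 \<le> d G" "d G \<le> N G"
      unfolding d_def N_def cliques_insert(1)[OF e2] by simp_all
    have "r2 (?K (k + 2)) \<le> r2 (?K (k + 2) \<union> ?T (k + 2))"
      "r2 (?K (k + 2) \<union> ?T (k + 2)) \<le> r2 (?K (k + 2)) + card (?T (k + 2))"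
      using fin by (intro r2.rk_mono r2.rk_Un_le; simp)+
    then show "0 \<le> d'" "d' \<le> N' G"
      unfolding d'_def N'_def cliques_insert(1)[OF e2] by simp_all
  qed
  have "real (card (cliques V (k + 1) (insert e G))) = real (card (cliques V (k + 1) (G - {e}))) + N G"
    using card_cliques_insert[OF V(1) e2] by (simp add: N_def)
  then have eq: "excess (insert e G) - excess (G - {e}) - \<mu> = (N G - \<mu>) - d G - d'"
    by (simp add: excess_def d_def d'_def)
  have "(excess (insert e G) - excess (G - {e}) - \<mu>)\<^sup>2 \<le> 3 * ((N G - \<mu>)\<^sup>2 + (d G)\<^sup>2 + d'\<^sup>2)"
    unfolding eq by (rule square_of_three_le)
  also have "\<dots> \<le> 3 * ((N G - \<mu>)\<^sup>2 + (2 * \<mu> * d G + (N G - \<mu>)\<^sup>2) + (N' G)\<^sup>2)"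
    by (intro mult_left_mono add_mono order_refl square_le_of_le[OF d] power_mono[OF d'(2,1)]) simp
  finally show ?thesis by simp
qed

definition error where
  "error = (6 * (real k * 2 ^ (k + 1)) / c\<^sup>2 + 24 * 2 ^ m / c) / x + 3 * (1 + real k * 2 ^ (k + 2)) / c\<^sup>2 * y"

text \<open>
  The Efron--Stein inequality applied to \<open>\<beta> - \<mu> M\<close>, whose increments are \<open>D\<^sub>e \<beta> - \<mu>\<close>. The three
  kinds of terms that the constant \<open>error\<close> combines are of relative orders \<open>1 / x\<close>, \<open>1 / x\<close> and \<open>y\<close>.
\<close>

theorem variance_of_linearization_error:
  "subset_variance E p (\<lambda>G. excess G - \<mu> * real (card G)) \<le> error * (\<mu>\<^sup>2 * (real (card E) * p * (1 - p)))"
proof -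
  let ?f = "\<lambda>G. excess G - \<mu> * real (card G)"
  let ?N = "\<lambda>e G. real (card (cliques_through V (k + 1) e G))"
  let ?N' = "\<lambda>e G. real (card (cliques_through V (k + 2) e G))"
  let ?d = "\<lambda>e G. real (r1 (cliques V (k + 1) (insert e G))) - real (r1 (cliques V (k + 1) (G - {e})))"
  let ?M = "real (card E)"
  let ?B = "real k * 2 ^ (k + 1) * (A\<^sup>2 / x)" and ?B' = "(1 + real k * 2 ^ (k + 2)) * (A\<^sup>2 * y)"
  let ?D = "2 ^ m * (real n ^ k * p ^ (k choose 2)) / p"
  have A2: "A\<^sup>2 \<le> \<mu>\<^sup>2 / c\<^sup>2"
  proof -
    have "(c * A)\<^sup>2 \<le> \<mu>\<^sup>2" using cA_le c(1) A_nonneg by (intro power_mono) auto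
    then show ?thesis using c(1) by (simp add: power_mult_distrib field_simps)
  qed
  have M_ge: "(real n)\<^sup>2 / 4 \<le> ?M"
  proof -
    have "card E = n choose 2" using card_edges_of[OF V(1)] V(2) by simp
    moreover have "(real n / real 2) ^ 2 \<le> real (n choose 2)" by (rule binomial_ge_n_over_k_pow_k[OF n])
    ultimately show ?thesis by (simp add: power_divide)
  qed
  have "(\<Sum>e\<in>E. subset_mean E p (\<lambda>G. (?f (insert e G) - ?f (G - {e}))\<^sup>2)) \<le>
      (\<Sum>e\<in>E. 6 * ?B + 6 * \<mu> * subset_mean E p (?d e) + 3 * ?B')"
  proof (rule sum_mono)
    fix e assume e: "e \<in> E"
    then have e': "e \<subseteq> V" "card e = 2" by (auto simp: edges_of_def)
    have "subset_mean E p (\<lambda>G. (?f (insert e G) - ?f (G - {e}))\<^sup>2) \<le>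
        subset_mean E p (\<lambda>G. 6 * (?N e G - \<mu>)\<^sup>2 + 6 * \<mu> * ?d e G + 3 * (?N' e G)\<^sup>2)"
    proof (rule subset_mean_mono)
      fix G assume "G \<subseteq> E"
      then have "finite G" using finE finite_subset by blast
      then have "real (card (insert e G)) = real (card (G - {e})) + 1"
        by (simp add: card.insert_remove)
      then have eq: "?f (insert e G) - ?f (G - {e}) = excess (insert e G) - excess (G - {e}) - \<mu>"
        by (simp only: distrib_left)
      show "(?f (insert e G) - ?f (G - {e}))\<^sup>2 \<le> 6 * (?N e G - \<mu>)\<^sup>2 + 6 * \<mu> * ?d e G + 3 * (?N' e G)\<^sup>2"
        unfolding eq by (rule excess_increment_bound[OF e])
    qed (use p in auto)
    also have "\<dots> = 6 * subset_mean E p (\<lambda>G. (?N e G - \<mu>)\<^sup>2) + 6 * \<mu> * subset_mean E p (?d e) + 3 * subset_mean E p (\<lambda>G. (?N' e G)\<^sup>2)"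
      by (simp only: subset_mean_add subset_mean_cmult)
    also have "\<dots> \<le> 6 * ?B + 6 * \<mu> * subset_mean E p (?d e) + 3 * ?B'"
    proof -
      have "subset_mean E p (\<lambda>G. (?N e G - \<mu>)\<^sup>2) \<le> ?B"
        unfolding \<mu>_def by (rule variance_cliques_through[OF V e'])
      moreover have "subset_mean E p (\<lambda>G. (?N' e G)\<^sup>2) \<le> ?B'"
        by (rule second_moment_larger_cliques[OF V e'])
      ultimately show ?thesis by linarith
    qed
    finally show "subset_mean E p (\<lambda>G. (?f (insert e G) - ?f (G - {e}))\<^sup>2) \<le> \<dots>" .
  qed
  also have "\<dots> = ?M * (6 * ?B) + 6 * \<mu> * (\<Sum>e\<in>E. subset_mean E p (?d e)) + ?M * (3 * ?B')"
    by (simp add: sum.distrib sum_distrib_left)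
  also have "\<dots> \<le> ?M * (6 * ?B) + 6 * \<mu> * ?D + ?M * (3 * ?B')"
    using expected_rank_drops_le \<mu>_pos by (intro add_mono mult_left_mono order_refl) auto
  also have "\<dots> \<le> ?M * (6 * (real k * 2 ^ (k + 1) * (\<mu>\<^sup>2 / c\<^sup>2 / x))) + 6 * \<mu> * (2 ^ m * (4 / (c * x) * (?M * \<mu>))) +
      ?M * (3 * ((1 + real k * 2 ^ (k + 2)) * (\<mu>\<^sup>2 / c\<^sup>2 * y)))"
  proof (intro add_mono)
    show "?M * (6 * ?B) \<le> ?M * (6 * (real k * 2 ^ (k + 1) * (\<mu>\<^sup>2 / c\<^sup>2 / x)))"
      using A2 x_ge_1 by (intro mult_left_mono divide_right_mono) auto
    show "?M * (3 * ?B') \<le> ?M * (3 * ((1 + real k * 2 ^ (k + 2)) * (\<mu>\<^sup>2 / c\<^sup>2 * y)))"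
      using A2 y_nonneg by (intro mult_left_mono mult_right_mono) auto
    have "real n ^ k * p ^ (k choose 2) / p = 4 / (c * x) * ((real n)\<^sup>2 / 4 * (c * A))"
    proof -
      have "real n ^ (k - 1) * (real n)\<^sup>2 = real n ^ k * real n"
        using k by (cases k) (simp_all add: power2_eq_square)
      moreover have "p ^ (m - 1) * p = p ^ (k choose 2) * p ^ k"
      proof -
        have "p ^ (m - 1) * p = p ^ m" using m_pos by (intro power_minus_mult) simp
        then show ?thesis by (simp only: power_add[symmetric] m_pred[symmetric])
      qed
      moreover have "4 / (c * x) * ((real n)\<^sup>2 / 4 * (c * A)) = (real n ^ (k - 1) * (real n)\<^sup>2) * (p ^ (m - 1) * p) / (x * p)"
        using c(1) p x_ge_1 by (simp add: A_def field_simps)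
      ultimately have "4 / (c * x) * ((real n)\<^sup>2 / 4 * (c * A)) = (real n ^ k * real n) * (p ^ (k choose 2) * p ^ k) / (x * p)"
        by simp
      also have "\<dots> = real n ^ k * p ^ (k choose 2) * x / (x * p)" by (simp add: x_def)
      finally show ?thesis using x_ge_1 by simp
    qed
    also have "\<dots> \<le> 4 / (c * x) * (?M * \<mu>)"
      using M_ge cA_le c(1) x_ge_1 A_nonneg by (intro mult_left_mono mult_mono) auto
    finally have "2 ^ m * (real n ^ k * p ^ (k choose 2) / p) \<le> 2 ^ m * (4 / (c * x) * (?M * \<mu>))"
      by (intro mult_left_mono) auto
    then show "6 * \<mu> * ?D \<le> 6 * \<mu> * (2 ^ m * (4 / (c * x) * (?M * \<mu>)))"
      using \<mu>_pos by (intro mult_left_mono) auto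
  qed
  also have "\<dots> = error * (\<mu>\<^sup>2 * ?M)"
    by (simp add: error_def add_divide_distrib power2_eq_square algebra_simps)
  finally have "p * (1 - p) * (\<Sum>e\<in>E. subset_mean E p (\<lambda>G. (?f (insert e G) - ?f (G - {e}))\<^sup>2)) \<le>
      p * (1 - p) * (error * (\<mu>\<^sup>2 * ?M))"
    using p by (intro mult_left_mono) auto
  also have "p * (1 - p) * (error * (\<mu>\<^sup>2 * ?M)) = error * (\<mu>\<^sup>2 * (?M * p * (1 - p)))" by simp
  finally show ?thesis
    using p by (intro order_trans[OF efron_stein[OF finE]]) auto
qed

end

section \<open>Asymptotics in the range of the parameters\<close>

lemma faces_clique_complex:
  assumes "finite V"
  shows "faces k (clique_complex V G) = cliques V (k + 1) G"
proof -
  have edges: "(\<forall>u\<in>\<sigma>. \<forall>v\<in>\<sigma>. u \<noteq> v \<longrightarrow> {u, v} \<in> G) \<longleftrightarrow> edges_of \<sigma> \<subseteq> G" for \<sigma> :: "'a set"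
  proof
    assume G: "\<forall>u\<in>\<sigma>. \<forall>v\<in>\<sigma>. u \<noteq> v \<longrightarrow> {u, v} \<in> G"
    show "edges_of \<sigma> \<subseteq> G"
    proof
      fix e assume "e \<in> edges_of \<sigma>"
      then obtain u v where "e = {u, v}" "u \<noteq> v" "e \<subseteq> \<sigma>" by (auto simp: edges_of_def card_2_iff)
      then show "e \<in> G" using G by auto
    qed
  next
    have "{u, v} \<in> edges_of \<sigma>" if "u \<in> \<sigma>" "v \<in> \<sigma>" "u \<noteq> v" for u v
      using that by (simp add: edges_of_def)
    moreover assume "edges_of \<sigma> \<subseteq> G"
    ultimately show "\<forall>u\<in>\<sigma>. \<forall>v\<in>\<sigma>. u \<noteq> v \<longrightarrow> {u, v} \<in> G" by blast
  qed
  have "\<sigma> \<noteq> {} \<and> finite \<sigma>" if "card \<sigma> = k + 1" for \<sigma> :: "'a set"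
    using that by (metis add_is_0 card.empty card.infinite one_neq_zero)
  then show ?thesis
    unfolding faces_def cliques_def clique_complex_def edges by auto
qed

lemma finite_complex_clique_complex:
  assumes "finite V"
  shows "finite_complex (clique_complex V G)"
proof
  show "finite (faces k (clique_complex V G))" for k
    unfolding faces_clique_complex[OF assms] by (rule finite_cliques[OF assms])
  show "finite \<sigma>" if "\<sigma> \<in> clique_complex V G" for \<sigma>
    using that by (simp add: clique_complex_def)
  show "\<tau> \<in> clique_complex V G" if "\<sigma> \<in> clique_complex V G" "\<tau> \<subseteq> \<sigma>" "\<tau> \<noteq> {}" for \<sigma> \<tau>
  proof -
    have "finite \<tau>" using that finite_subset by (auto simp: clique_complex_def)
    then show ?thesis using that by (auto simp: clique_complex_def)
  qed
qed

lemma random_graph_eq: "random_graph n p = random_subset (edges_of {..<n}) p"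
  unfolding random_graph_def random_subset_def potential_edges_def edges_of_def ..

text \<open>
  For fixed \<open>k\<close> the factor of \<open>n\<^sup>k\<^sup>-\<^sup>1\<close> is a positive constant, which serves as \<open>c\<close>.
\<close>

lemma binomial_ge_power:
  assumes "1 \<le> k" "4 \<le> n" "k + 1 \<le> n"
  shows "(1 / (2 * real k)) ^ (k - 1) * real n ^ (k - 1) \<le> real ((n - 2) choose (k - 1))"
proof (cases "k = 1")
  case False
  then have "1 < k" using assms(1) by simp
  have "(1 / (2 * real k)) ^ (k - 1) * real n ^ (k - 1) = ((real n / 2) / real k) ^ (k - 1)"
    by (simp flip: power_mult_distrib)
  also have "\<dots> \<le> (real (n - 2) / real (k - 1)) ^ (k - 1)"
    using \<open>1 < k\<close> assms(2) by (intro power_mono frac_le) auto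
  also have "\<dots> \<le> real ((n - 2) choose (k - 1))"
    using assms(3) by (intro binomial_ge_n_over_k_pow_k) simp
  finally show ?thesis .
qed simp

text \<open>
  The hypotheses bound \<open>n p\<^sup>k\<close> below by \<open>n\<^sup>k\<^sup>\<delta>\<close> and \<open>n p\<^sup>k\<^sup>+\<^sup>1\<close> above by the power of \<open>n\<close> with exponent
  \<open>- (k + 1) \<delta>\<close>, once \<open>n\<close> is large.
\<close>

lemma expected_cofaces_limits:
  fixes k :: nat and p :: "nat \<Rightarrow> real" and \<delta> :: real
  assumes k: "k \<ge> 1" and p: "\<And>n. 0 \<le> p n \<and> p n \<le> 1" and \<delta>: "\<delta> > 0"
    and lower: "filterlim (\<lambda>n. p n / real n powr (- 1 / real k + \<delta>)) at_top sequentially"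
    and upper: "(\<lambda>n. p n / real n powr (- 1 / real (k + 1) - \<delta>)) \<longlonglongrightarrow> 0"
  shows "filterlim (\<lambda>n. real n * p n ^ k) at_top sequentially"
    and "(\<lambda>n. real n * p n ^ (k + 1)) \<longlonglongrightarrow> 0"
    and "p \<longlonglongrightarrow> 0"
proof -
  have power: "(real n powr (a / real j + b)) ^ j * real n = real n powr (a + 1 + real j * b)"
    if "n > 0" "j > 0" for n j :: nat and a b :: real
  proof -
    have "(real n powr (a / real j + b)) ^ j = real n powr (a + real j * b)"
      using that by (simp add: powr_power algebra_simps)
    moreover have "real n = real n powr 1" using that by simp
    ultimately show ?thesis by (metis powr_add add.commute add.left_commute)
  qed
  have "\<forall>\<^sub>F n in sequentially. 1 \<le> p n / real n powr (- 1 / real k + \<delta>)"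
    using lower unfolding filterlim_at_top by blast
  then have low: "\<forall>\<^sub>F n in sequentially. real n powr (real k * \<delta>) \<le> real n * p n ^ k"
    using eventually_gt_at_top[of 0]
  proof eventually_elim
    case (elim n)
    then have "real n powr (- 1 / real k + \<delta>) \<le> p n" by (simp add: field_simps)
    have "real n powr (real k * \<delta>) = (real n powr (- 1 / real k + \<delta>)) ^ k * real n"
      using power[of n k "-1" \<delta>] elim k by simp
    also have "\<dots> \<le> p n ^ k * real n"
      using \<open>real n powr (- 1 / real k + \<delta>) \<le> p n\<close> by (intro mult_right_mono power_mono) auto
    finally show ?case by (simp only: mult.commute)
  qed
  have "filterlim (\<lambda>n. exp (real k * \<delta> * ln (real n))) at_top sequentially"
    by (rule filterlim_compose[OF exp_at_top filterlim_tendsto_pos_mult_at_top[OF tendsto_const _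
          filterlim_compose[OF ln_at_top filterlim_real_sequentially]]]) (use k \<delta> in simp)
  moreover have "\<forall>\<^sub>F n in sequentially. exp (real k * \<delta> * ln (real n)) \<le> real n powr (real k * \<delta>)"
    using eventually_gt_at_top[of 0] by eventually_elim (simp add: powr_def)
  ultimately have "filterlim (\<lambda>n. real n powr (real k * \<delta>)) at_top sequentially"
    by (rule filterlim_at_top_mono)
  then show "filterlim (\<lambda>n. real n * p n ^ k) at_top sequentially"
    using low by (rule filterlim_at_top_mono)
  have "\<forall>\<^sub>F n in sequentially. p n / real n powr (- 1 / real (k + 1) - \<delta>) < 1"
    by (rule order_tendstoD(2)[OF upper]) simp
  then have up: "\<forall>\<^sub>F n in sequentially. p n \<le> real n powr (- 1 / real (k + 1) - \<delta>) \<and>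
      real n * p n ^ (k + 1) \<le> real n powr (- (real (k + 1) * \<delta>))"
    using eventually_gt_at_top[of 0]
  proof eventually_elim
    case (elim n)
    then have le: "p n \<le> real n powr (- 1 / real (k + 1) - \<delta>)" by (simp add: field_simps)
    then have "p n ^ (k + 1) * real n \<le> (real n powr (- 1 / real (k + 1) + - \<delta>)) ^ (k + 1) * real n"
      using p[of n] by (intro mult_right_mono power_mono) auto
    also have "\<dots> = real n powr (- (real (k + 1) * \<delta>))"
      using power[of n "k + 1" "-1" "- \<delta>"] elim by simp
    finally show ?case using le by (simp add: mult.commute)
  qed
  have neg: "(\<lambda>n. real n powr a) \<longlonglongrightarrow> 0" if "a < 0" for a
    by (rule tendsto_neg_powr[OF that filterlim_real_sequentially])
  show "(\<lambda>n. real n * p n ^ (k + 1)) \<longlonglongrightarrow> 0"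
  proof (rule tendsto_sandwich[OF _ _ tendsto_const neg])
    show "\<forall>\<^sub>F n in sequentially. 0 \<le> real n * p n ^ (k + 1)" using p by simp
    show "\<forall>\<^sub>F n in sequentially. real n * p n ^ (k + 1) \<le> real n powr (- (real (k + 1) * \<delta>))"
      using up by eventually_elim simp
  qed (use \<delta> in simp)
  show "p \<longlonglongrightarrow> 0"
  proof (rule tendsto_sandwich[OF _ _ tendsto_const neg])
    show "\<forall>\<^sub>F n in sequentially. 0 \<le> p n" using p by simp
    show "\<forall>\<^sub>F n in sequentially. p n \<le> real n powr (- 1 / real (k + 1) - \<delta>)"
      using up by eventually_elim simp
    have "0 < 1 / real (k + 1)" by simp
    then show "- 1 / real (k + 1) - \<delta> < 0"
      using \<delta> unfolding minus_divide_left[symmetric] by linarith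
  qed
qed

theorem theorem1p1:
  fixes k :: nat and p :: "nat \<Rightarrow> real" and \<delta> :: real
  assumes "k \<ge> 1"
    and "\<And>n. 0 \<le> p n \<and> p n \<le> 1"
    and "\<delta> > 0"
    and "filterlim (\<lambda>n. p n / real n powr (- 1 / real k + \<delta>)) at_top sequentially"
    and "(\<lambda>n. p n / real n powr (- 1 / real (k + 1) - \<delta>)) \<longlonglongrightarrow> 0"
  shows "weak_conv_m
    (\<lambda>n. let X = random_clique_complex n (p n); \<beta> = (\<lambda>K. real (betti k K)) in
       distr (measure_pmf X) borel
         (\<lambda>K. (\<beta> K - measure_pmf.expectation X \<beta>) / sqrt (measure_pmf.variance X \<beta>)))
    std_normal_distribution"
proof -
  let ?E = "\<lambda>n::nat. edges_of {..<n}"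
  define f where "f n G = real (betti k (clique_complex {..<n} G))" for n :: nat and G
  define c where "c = (1 / (2 * real k)) ^ (k - 1)"
  define \<mu> where "\<mu> n = real ((n - 2) choose (k - 1)) * p n ^ (((k + 1) choose 2) - 1)" for n
  define x where "x n = real n * p n ^ k" for n
  define y where "y n = real n * p n ^ (k + 1)" for n
  \<comment> \<open>the relative error of the linearization, as a function of \<open>n\<close>\<close>
  define \<rho> where "\<rho> n = (6 * (real k * 2 ^ (k + 1)) / c\<^sup>2 + 24 * 2 ^ ((k + 1) choose 2) / c) / x n +
    3 * (1 + real k * 2 ^ (k + 2)) / c\<^sup>2 * y n" for n
  have fin: "finite (?E n)" for n by (simp add: finite_edges_of)
  note p01 = assms(2)
  have x_lim: "filterlim x at_top sequentially" and y_lim: "y \<longlonglongrightarrow> 0" and p_lim: "p \<longlonglongrightarrow> 0"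
    using expected_cofaces_limits[OF assms] by (simp_all add: x_def[abs_def] y_def[abs_def])
  have x_ge: "\<forall>\<^sub>F n in sequentially. 1 \<le> x n" using x_lim unfolding filterlim_at_top by blast
  have y_le: "\<forall>\<^sub>F n in sequentially. y n < 1" by (rule order_tendstoD(2)[OF y_lim]) simp
  have main: "\<forall>\<^sub>F n in sequentially. \<mu> n > 0 \<and> subset_variance (?E n) (p n) (\<lambda>G. f n G - \<mu> n * real (card G)) \<le>
      \<rho> n * ((\<mu> n)\<^sup>2 * (real (card (?E n)) * p n * (1 - p n)))"
    using x_ge y_le eventually_ge_at_top[of "max 4 (k + 1)"]
  proof eventually_elim
    case (elim n)
    let ?r = "\<lambda>A. fn.dim (simplex_boundary ` A)"
    have "p n \<noteq> 0" using elim(1) assms(1) by (auto simp: x_def power_0_left)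
    then have p_pos: "0 < p n" using p01[of n] by (simp add: less_le)
    have rank_le: "?r (cliques {..<n} (k + 1) G) \<le> card (cliques {..<n} k G)" for G
    proof -
      interpret finite_complex "clique_complex {..<n} G" by (rule finite_complex_clique_complex) simp
      show ?thesis
        using dim_boundary_faces_le[of "cliques {..<n} (k + 1) G" "k - 1"] assms(1)
        by (simp add: faces_clique_complex)
    qed
    interpret L: clique_ranks k n "p n" ?r ?r "{..<n}" c
    proof (intro clique_ranks.intro clique_ranks_axioms.intro clique_range.intro fn.matroid_rank_dim_image)
      show "c * real n ^ (k - 1) \<le> real ((n - 2) choose (k - 1))"
        unfolding c_def using elim assms(1) by (intro binomial_ge_power) auto
    qed (use assms(1) p_pos p01 elim rank_le in \<open>auto simp: x_def y_def c_def\<close>)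
    have excess_eq: "f n G = L.excess G" for G
    proof -
      interpret finite_complex "clique_complex {..<n} G" by (rule finite_complex_clique_complex) simp
      show ?thesis
        using betti_eq[of k] assms(1) by (simp add: f_def L.excess_def faces_clique_complex)
    qed
    have "\<mu> n = L.\<mu>" "\<rho> n = L.error"
      by (simp_all add: \<mu>_def L.\<mu>_def L.m_def \<rho>_def L.error_def x_def y_def L.x_def L.y_def)
    then show ?case
      using L.\<mu>_pos L.variance_of_linearization_error by (simp add: excess_eq)
  qed
  have "\<rho> \<longlonglongrightarrow> 0"
  proof -
    have "(\<lambda>n. a / x n) \<longlonglongrightarrow> 0" for a
      by (rule tendsto_divide_0[OF tendsto_const filterlim_at_top_imp_at_infinity[OF x_lim]])
    from tendsto_add[OF this tendsto_mult_right_zero[OF y_lim]]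
    have "(\<lambda>n. a / x n + b * y n) \<longlonglongrightarrow> 0" for a b by simp
    then show ?thesis unfolding \<rho>_def[abs_def] .
  qed
  moreover have "filterlim (\<lambda>n. real (card (?E n)) * p n * (1 - p n)) at_top sequentially"
  proof (rule filterlim_at_top_mono)
    show "filterlim (\<lambda>n. 1 / 8 * x n) at_top sequentially"
      by (rule filterlim_tendsto_pos_mult_at_top[OF tendsto_const _ x_lim]) simp
    \<comment> \<open>The number of pairs is of order \<open>n\<^sup>2\<close>, and \<open>n p \<ge> n p\<^sup>k\<close>.\<close>
    have "\<forall>\<^sub>F n in sequentially. p n < 1 / 2" by (rule order_tendstoD(2)[OF p_lim]) simp
    then show "\<forall>\<^sub>F n in sequentially. 1 / 8 * x n \<le> real (card (?E n)) * p n * (1 - p n)"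
      using eventually_ge_at_top[of 2]
    proof eventually_elim
      case (elim n)
      have "(real n / real 2) ^ 2 \<le> real (n choose 2)" by (rule binomial_ge_n_over_k_pow_k[OF elim(2)])
      then have "real n * real n / 4 \<le> real (card (?E n))"
        by (simp add: card_edges_of power2_eq_square)
      moreover have "real n / 4 \<le> real n * real n / 4" using elim by (intro divide_right_mono) auto
      ultimately have M: "real n / 4 \<le> real (card (?E n))" by linarith
      have "p n ^ k \<le> p n ^ 1" using p01[of n] assms(1) by (intro power_decreasing) auto
      then have "1 / 8 * x n \<le> (real n / 4 * p n) * (1 / 2)"
        unfolding x_def by (simp add: mult_left_mono)
      also have "\<dots> \<le> (real (card (?E n)) * p n) * (1 - p n)"
        using M p01[of n] elim by (intro mult_mono mult_right_mono) auto
      finally show ?case .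
    qed
  qed
  ultimately have "weak_conv_m
      (\<lambda>n. distr (measure_pmf (random_subset (?E n) (p n))) borel
        (\<lambda>G. (f n G - subset_mean (?E n) (p n) (f n)) / sqrt (subset_variance (?E n) (p n) (f n))))
      std_normal_distribution"
    using main by (intro clt_of_linear_approximation[where \<mu> = \<mu> and \<rho> = \<rho>] fin p01) (auto elim: eventually_mono)
  moreover have "(let X = random_clique_complex n (p n); \<beta> = (\<lambda>K. real (betti k K)) in
       distr (measure_pmf X) borel
         (\<lambda>K. (\<beta> K - measure_pmf.expectation X \<beta>) / sqrt (measure_pmf.variance X \<beta>))) =
      distr (measure_pmf (random_subset (?E n) (p n))) borel
        (\<lambda>G. (f n G - subset_mean (?E n) (p n) (f n)) / sqrt (subset_variance (?E n) (p n) (f n)))" for n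
  proof -
    have mean: "measure_pmf.expectation (random_clique_complex n (p n)) g =
        subset_mean (?E n) (p n) (\<lambda>G. g (clique_complex {..<n} G))" for g :: "_ \<Rightarrow> real"
      unfolding random_clique_complex_def random_graph_eq integral_map_pmf
      using p01[of n] by (intro expectation_random_subset fin) auto
    have "distr (measure_pmf (random_clique_complex n (p n))) borel g =
        distr (measure_pmf (random_subset (?E n) (p n))) borel (\<lambda>G. g (clique_complex {..<n} G))" for g :: "_ \<Rightarrow> real"
      unfolding random_clique_complex_def random_graph_eq map_pmf_rep_eq
      by (subst distr_distr) (auto simp: comp_def)
    then show ?thesis
      by (simp only: Let_def mean f_def[symmetric] subset_variance_def)
  qed
  ultimately show ?thesis by simp
qed

end
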